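(* For generic values of the inhomogeneity parameters $w_1,\dots,w_N$ (and of $q$), the transfer matrix $T^{(1)}(z)=\mathrm i(\mathcal B(z)+\mathcal C(z))$ with the anti-diagonal twist possesses the non-degenerate eigenvalue $\theta^{(1)}(z)=0$: up to normalisation there is exactly one covector $\langle\psi_{\rm AD}|$ with $\langle\psi_{\rm AD}|T^{(1)}(z)=0$ for all $z$, and exactly one vector $|\psi_{\rm AD}\rangle$ with $T^{(1)}(z)|\psi_{\rm AD}\rangle=0$ for all $z$. In a suitable normalisation, their projections onto the separation of variables basis are, for all $\bm h\in\{0,1,2\}^N$, $$\langle\psi_{\rm AD}||\bm h\rangle\rangle=\prod_{i,j=1}^N\frac{[q^{1-h_i}w_i/w_j]}{[qw_i/w_j]},\qquad\langle\langle\bm h||\psi_{\rm AD}\rangle=\prod_{i,j=1}^N\frac{[q^{2(h_i-1)}w_i/w_j]}{[q^{-2}w_i/w_j]}.$$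
   Context: Notation: $[z]=z-z^{-1}$; $q\in\mathbb C^\times$; $\mathbb C^2$ has basis $|{\uparrow}\rangle,|{\downarrow}\rangle$ and $\mathbb C^3$ has basis $|{\Uparrow}\rangle,|0\rangle,|{\Downarrow}\rangle$. $R(z)$ is the operator on $\mathbb C^2\otimes\mathbb C^3$ with diagonal entries $[q^2z],[qz],[z],[z],[qz],[q^2z]$ on $|{\uparrow\Uparrow}\rangle,|{\uparrow}0\rangle,|{\uparrow\Downarrow}\rangle,|{\downarrow\Uparrow}\rangle,|{\downarrow}0\rangle,|{\downarrow\Downarrow}\rangle$, and whose only non-zero off-diagonal entries are those between $|{\uparrow}0\rangle$ and $|{\downarrow\Uparrow}\rangle$ and between $|{\uparrow\Downarrow}\rangle$ and $|{\downarrow}0\rangle$ (both directions), all equal to $\sqrt{[q][q^2]}$ (a fixed root). For $w_1,\dots,w_N\in\mathbb C^\times$ and auxiliary space $a\simeq\mathbb C^2$, $$R_{a,N}(q^{-1}z/w_N)\cdots R_{a,1}(q^{-1}z/w_1)=\begin{pmatrix}\mathcal A(z)&\mathcal B(z)\\ \mathcal C(z)&\mathcal D(z)\end{pmatrix}_a ,$$ with $\mathcal A,\dots,\mathcal D$ acting on $(\mathbb C^3)^{\otimes N}$. Put $a(z)=\prod_{i=1}^N[qz/w_i]$, $d(z)=\prod_{i=1}^N[q^{-1}z/w_i]$, $|\wedge\rangle=|{\Uparrow\cdots\Uparrow}\rangle$, $\langle\wedge|=|\wedge\rangle^t$. The separation of variables (height) states are, for $\bm h=(h_1,\dots,h_N)\in\{0,1,2\}^N$,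 $$||\bm h\rangle\rangle=\prod_{j=1}^N\prod_{h=0}^{h_j-1}\frac{\mathcal B(q^{1-h}w_j)}{a(q^{1-h}w_j)}|\wedge\rangle,\qquad\langle\langle\bm h||=\langle\wedge|\prod_{j=1}^N\prod_{h=0}^{h_j-1}\frac{\mathcal C(q^{1-h}w_j)}{d(q^{-h}w_j)},$$ empty products being $1$ (the $\mathcal B$'s commute among themselves, as do the $\mathcal C$'s). For generic parameters these form bases of $(\mathbb C^3)^{\otimes N}$ and of its dual. "Generic" means outside a proper Zariski-closed subset of parameter space. *)

theory Defs
  imports "HOL-Analysis.Analysis"
begin

text \<open>
  The sites of the chain are the elements of a finite linearly ordered type \<open>'n\<close>, standing for
  \<open>1 < \<dots> < N\<close> with \<open>N = CARD('n)\<close>; every \<open>N \<ge> 1\<close> is realised, e.g. by the numeral types.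
\<close>

datatype spin_half = Up | Dn

datatype spin_one = UUp | Zero | DDn

instance spin_half :: finite
proof
  have "(UNIV :: spin_half set) \<subseteq> {Up, Dn}"
    using spin_half.exhaust by blast
  then show "finite (UNIV :: spin_half set)"
    using finite_subset by blast
qed

instance spin_one :: finite
proof
  have "(UNIV :: spin_one set) \<subseteq> {UUp, Zero, DDn}"
    using spin_one.exhaust by blast
  then show "finite (UNIV :: spin_one set)"
    using finite_subset by blast
qed

text \<open>
  A tensor product of coordinate spaces is the coordinate space over the product of the index
  sets: \<open>(\<complex>\<^sup>3)\<^bsup>\<otimes>N\<^esup>\<close> has the basis of configurations \<open>'n \<Rightarrow> spin_one\<close>, and
  \<open>\<complex>\<^sup>2 \<otimes> (\<complex>\<^sup>3)\<^bsup>\<otimes>N\<^esup>\<close> the basis of pairs. Operators are matrices, with \<open>M $ x $ y\<close> the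
  coefficient of \<open>x\<close> in the image of \<open>y\<close>.
\<close>

type_synonym 'n chain_vec = "complex ^ ('n \<Rightarrow> spin_one)"
type_synonym 'n chain_op = "complex ^ ('n \<Rightarrow> spin_one) ^ ('n \<Rightarrow> spin_one)"
type_synonym 'n aux_chain_op =
  "complex ^ (spin_half \<times> ('n \<Rightarrow> spin_one)) ^ (spin_half \<times> ('n \<Rightarrow> spin_one))"

definition qbr :: "complex \<Rightarrow> complex" where
  "qbr z = z - inverse z"

fun R_diag :: "complex \<Rightarrow> complex \<Rightarrow> spin_half \<times> spin_one \<Rightarrow> complex" where
  "R_diag q z (Up, UUp) = qbr (q\<^sup>2 * z)"
| "R_diag q z (Up, Zero) = qbr (q * z)"
| "R_diag q z (Up, DDn) = qbr z"
| "R_diag q z (Dn, UUp) = qbr z"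
| "R_diag q z (Dn, Zero) = qbr (q * z)"
| "R_diag q z (Dn, DDn) = qbr (q\<^sup>2 * z)"

text \<open>The parameter \<open>r\<close> is the chosen square root of \<open>qbr q * qbr (q\<^sup>2)\<close>.\<close>

definition R_mat ::
    "complex \<Rightarrow> complex \<Rightarrow> complex \<Rightarrow> complex ^ (spin_half \<times> spin_one) ^ (spin_half \<times> spin_one)" where
  "R_mat q r z = (\<chi> x y.
     if x = y then R_diag q z x
     else if {x, y} = {(Up, Zero), (Dn, UUp)} \<or> {x, y} = {(Up, DDn), (Dn, Zero)} then r
     else 0)"

text \<open>The operator \<open>R\<^bsub>a,j\<^esub>(z)\<close>: it acts as \<open>R(z)\<close> on \<open>a\<close> and the site \<open>j\<close>, trivially elsewhere.\<close>

definition R_site :: "complex \<Rightarrow> complex \<Rightarrow> 'n::finite \<Rightarrow> complex \<Rightarrow> 'n aux_chain_op" where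
  "R_site q r j z = (\<chi> x y.
     if \<forall>k. k \<noteq> j \<longrightarrow> snd x k = snd y k
     then R_mat q r z $ (fst x, snd x j) $ (fst y, snd y j)
     else 0)"

definition sites :: "'n::{finite,linorder} list" where
  "sites = sorted_list_of_set UNIV"

text \<open>Since \<open>fold\<close> multiplies from the left, the last site is the leftmost factor.\<close>

definition monodromy ::
    "complex \<Rightarrow> complex \<Rightarrow> ('n::{finite,linorder} \<Rightarrow> complex) \<Rightarrow> complex \<Rightarrow> 'n aux_chain_op" where
  "monodromy q r w z = fold (\<lambda>j M. R_site q r j (inverse q * z / w j) ** M) sites (mat 1)"

definition aux_block :: "spin_half \<Rightarrow> spin_half \<Rightarrow> 'n::finite aux_chain_op \<Rightarrow> 'n chain_op" where
  "aux_block a b M = (\<chi> s t. M $ (a, s) $ (b, t))"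

definition B_op ::
    "complex \<Rightarrow> complex \<Rightarrow> ('n::{finite,linorder} \<Rightarrow> complex) \<Rightarrow> complex \<Rightarrow> 'n chain_op" where
  "B_op q r w z = aux_block Up Dn (monodromy q r w z)"

definition C_op ::
    "complex \<Rightarrow> complex \<Rightarrow> ('n::{finite,linorder} \<Rightarrow> complex) \<Rightarrow> complex \<Rightarrow> 'n chain_op" where
  "C_op q r w z = aux_block Dn Up (monodromy q r w z)"

definition transfer_AD ::
    "complex \<Rightarrow> complex \<Rightarrow> ('n::{finite,linorder} \<Rightarrow> complex) \<Rightarrow> complex \<Rightarrow> 'n chain_op" where
  "transfer_AD q r w z = (\<chi> s t. \<i> * (B_op q r w z + C_op q r w z) $ s $ t)"

definition a_fun :: "complex \<Rightarrow> ('n::finite \<Rightarrow> complex) \<Rightarrow> complex \<Rightarrow> complex" where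
  "a_fun q w z = (\<Prod>i\<in>UNIV. qbr (q * z / w i))"

definition d_fun :: "complex \<Rightarrow> ('n::finite \<Rightarrow> complex) \<Rightarrow> complex \<Rightarrow> complex" where
  "d_fun q w z = (\<Prod>i\<in>UNIV. qbr (inverse q * z / w i))"

definition vac :: "'n::finite chain_vec" where
  "vac = axis (\<lambda>_. UUp) 1"

text \<open>
  The factors of a height state, indexed by pairs \<open>(j, k)\<close> with \<open>k < h j\<close>. The \<open>B\<close>-operators
  commute among themselves, as do the \<open>C\<close>-operators, so the order chosen here is immaterial.
\<close>

definition height_factors :: "('n::{finite,linorder} \<Rightarrow> nat) \<Rightarrow> ('n \<times> nat) list" where
  "height_factors h = concat (map (\<lambda>j. map (Pair j) [0..<h j]) sites)"

definition height_ket ::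
    "complex \<Rightarrow> complex \<Rightarrow> ('n::{finite,linorder} \<Rightarrow> complex) \<Rightarrow> ('n \<Rightarrow> nat) \<Rightarrow> 'n chain_vec" where
  "height_ket q r w h =
     foldr (\<lambda>(j, k) v. inverse (a_fun q w (q powi (1 - int k) * w j)) *s
                         (B_op q r w (q powi (1 - int k) * w j) *v v))
       (height_factors h) vac"

definition height_bra ::
    "complex \<Rightarrow> complex \<Rightarrow> ('n::{finite,linorder} \<Rightarrow> complex) \<Rightarrow> ('n \<Rightarrow> nat) \<Rightarrow> 'n chain_vec" where
  "height_bra q r w h =
     fold (\<lambda>(j, k) v. inverse (d_fun q w (q powi (- int k) * w j)) *s
                        (v v* C_op q r w (q powi (1 - int k) * w j)))
       (height_factors h) vac"

text \<open>
  The parameter space consists of the points \<open>(q, w)\<close> with all coordinates in \<open>\<complex>\<^sup>\<times>\<close>. Its Zariski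
  topology is induced from affine space: on this set a Laurent polynomial has the same zeros as
  the polynomial obtained by clearing denominators.
\<close>

inductive_set poly_funs :: "(complex \<times> ('n \<Rightarrow> complex) \<Rightarrow> complex) set" where
  const: "(\<lambda>_. c) \<in> poly_funs"
| coord_q: "fst \<in> poly_funs"
| coord_w: "(\<lambda>x. snd x i) \<in> poly_funs"
| add: "f \<in> poly_funs \<Longrightarrow> g \<in> poly_funs \<Longrightarrow> (\<lambda>x. f x + g x) \<in> poly_funs"
| mult: "f \<in> poly_funs \<Longrightarrow> g \<in> poly_funs \<Longrightarrow> (\<lambda>x. f x * g x) \<in> poly_funs"

definition param_space :: "(complex \<times> ('n \<Rightarrow> complex)) set" where
  "param_space = {(q, w). q \<noteq> 0 \<and> (\<forall>i. w i \<noteq> 0)}"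

definition zariski_closed :: "(complex \<times> ('n \<Rightarrow> complex)) set \<Rightarrow> bool" where
  "zariski_closed Z \<longleftrightarrow> (\<exists>F \<subseteq> poly_funs. Z = {x \<in> param_space. \<forall>f\<in>F. f x = 0})"

definition generically :: "(complex \<Rightarrow> ('n \<Rightarrow> complex) \<Rightarrow> bool) \<Rightarrow> bool" where
  "generically P \<longleftrightarrow>
     (\<exists>Z. zariski_closed Z \<and> Z \<subset> param_space \<and> (\<forall>(q, w) \<in> param_space - Z. P q w))"

end

theory Submission
  imports Defs
begin

text \<open>
  The monodromy matrix satisfies the RTT relations, whose consequences are an exchange relation
  between \<open>D(z)\<close> and \<open>B(y)\<close> or \<open>C(y)\<close> and a quantum determinant formula. Applying \<open>B\<close> or \<open>C\<close> at a zero of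
  the eigenvalue of \<open>D\<close> removes the unwanted term, so the height kets diagonalise \<open>D(z)\<close>, with
  eigenvalues \<open>\<Prod>\<^sub>i [q\<^bsup>h_i - 1\<^esup> z / w\<^sub>i]\<close>. These are pairwise distinct for generic
  parameters, so the kets form a basis. At the nodes
  \<open>q\<^bsup>1 - h_j\<^esup> w\<^sub>j\<close>, where these eigenvalues vanish, \<open>B\<close> raises \<open>h_j\<close> by one, and by the quantum
  determinant \<open>C\<close> lowers it by one. A covector annihilated by \<open>B(z) + C(z)\<close> therefore satisfies a
  two-step recursion in each \<open>h_j\<close>, which has exactly one solution up to scaling; conversely the
  vanishing at the \<open>N\<close> nodes suffices, because \<open>B(z) + C(z)\<close> has only \<open>N\<close> Laurent coefficients.
  The right kernel reduces to the left one by transposition, which reverses the order of the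
  sites and exchanges \<open>B\<close> and \<open>C\<close>.
\<close>

subsection \<open>Local relations\<close>

lemma sum_spin_half: "(\<Sum>a\<in>UNIV. f a) = f Up + f Dn" for f :: "spin_half \<Rightarrow> 'b::comm_monoid_add"
proof -
  have "(UNIV :: spin_half set) = {Up, Dn}"
    using spin_half.exhaust by blast
  then have "sum f UNIV = sum f {Up, Dn}" by (rule arg_cong)
  then show ?thesis by simp
qed

lemma sum_spin_one: "(\<Sum>a\<in>UNIV. f a) = f UUp + f Zero + f DDn"
  for f :: "spin_one \<Rightarrow> 'b::comm_monoid_add"
proof -
  have "(UNIV :: spin_one set) = {UUp, Zero, DDn}"
    using spin_one.exhaust by blast
  then have "sum f UNIV = sum f {UUp, Zero, DDn}" by (rule arg_cong)
  then show ?thesis by (simp add: add.assoc)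
qed

lemma sum_pair: "(\<Sum>x\<in>UNIV. f x) = (\<Sum>a\<in>UNIV. \<Sum>b\<in>UNIV. f (a, b))"
  for f :: "'a::finite \<times> 'b::finite \<Rightarrow> 'c::comm_monoid_add"
  by (simp add: sum.cartesian_product)

text \<open>The six-vertex R-matrix, which intertwines two auxiliary spaces.\<close>

definition R_half :: "complex \<Rightarrow> complex \<Rightarrow> spin_half \<times> spin_half \<Rightarrow> spin_half \<times> spin_half \<Rightarrow> complex" where
  "R_half q z x y =
     (if x = y then (if fst x = snd x then qbr (q * z) else qbr z)
      else if x = prod.swap y then qbr q else 0)"

text \<open>The Yang-Baxter relation for two auxiliary spaces and one site. Each of its 144 entries
  is a polynomial identity once \<open>r * r\<close> is replaced by its value.\<close>

lemma R_half_RLL: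
  assumes "q \<noteq> 0" "u \<noteq> 0" "v \<noteq> 0" "r\<^sup>2 = qbr q * qbr (q\<^sup>2)"
  shows "(\<Sum>e\<in>UNIV. \<Sum>f\<in>UNIV. R_half q (u / v) (a, b) (e, f) *
            (\<Sum>m\<in>UNIV. R_mat q r u $ (e, s) $ (c, m) * R_mat q r v $ (f, m) $ (d, t))) =
         (\<Sum>e\<in>UNIV. \<Sum>f\<in>UNIV.
            (\<Sum>m\<in>UNIV. R_mat q r v $ (b, s) $ (f, m) * R_mat q r u $ (a, m) $ (e, t)) *
            R_half q (u / v) (e, f) (c, d))"
proof -
  \<comment> \<open>Naming the inverses turns every entry into a polynomial identity modulo the
    relations \<open>i\<close>.\<close>
  obtain Q U V where Q: "inverse q = Q" "inverse u = U" "inverse v = V" by blast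
  have i: "q * Q = 1" "u * U = 1" "v * V = 1" using assms Q by auto
  have r: "r * r = (q - Q) * (q * q - Q * Q)"
    using assms(4) by (simp add: qbr_def Q power2_eq_square)
  have iV: "inverse V = v" using Q by auto
  note defs = sum_spin_half sum_spin_one R_half_def R_mat_def qbr_def Q iV power2_eq_square divide_inverse doubleton_eq_iff
  show ?thesis
    by (induct a; induct b; induct c; induct d; induct s; induct t; simp add: defs r; (algebra | use i in algebra)?)
qed

text \<open>\<open>R_half q (inverse q)\<close> is a multiple of the antisymmetriser, hence the quantum determinant.\<close>

lemma R_half_qdet:
  assumes "q \<noteq> 0" "u \<noteq> 0" "r\<^sup>2 = qbr q * qbr (q\<^sup>2)"
  shows "(\<Sum>e\<in>UNIV. \<Sum>f\<in>UNIV. R_half q (inverse q) (a, b) (e, f) *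
            (\<Sum>m\<in>UNIV. R_mat q r u $ (e, s) $ (c, m) * R_mat q r (q * u) $ (f, m) $ (d, t))) =
         (if s = t then qbr (q ^ 3 * u) * qbr u * R_half q (inverse q) (a, b) (c, d) else 0)"
proof -
  obtain Q U where Q: "inverse q = Q" "inverse u = U" by blast
  have i: "q * Q = 1" "u * U = 1" using assms Q by auto
  have r: "r * r = (q - Q) * (q * q - Q * Q)"
    using assms(3) by (simp add: qbr_def Q power2_eq_square)
  have iQ: "inverse Q = q" using Q by auto
  note defs = sum_spin_half sum_spin_one R_half_def R_mat_def qbr_def Q iQ power2_eq_square power3_eq_cube divide_inverse doubleton_eq_iff
  show ?thesis
    by (induct a; induct b; induct c; induct d; induct s; induct t; simp add: defs r; (algebra | use i in algebra)?)
qed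

subsection \<open>RTT relations\<close>

type_synonym 'c two_aux_op =
  "complex ^ (spin_half \<times> spin_half \<times> 'c) ^ (spin_half \<times> spin_half \<times> 'c)"

definition emb1 :: "complex ^ (spin_half \<times> 'c::finite) ^ (spin_half \<times> 'c) \<Rightarrow> 'c two_aux_op" where
  "emb1 M = (\<chi> x y. if fst (snd x) = fst (snd y)
     then M $ (fst x, snd (snd x)) $ (fst y, snd (snd y)) else 0)"

definition emb2 :: "complex ^ (spin_half \<times> 'c::finite) ^ (spin_half \<times> 'c) \<Rightarrow> 'c two_aux_op" where
  "emb2 M = (\<chi> x y. if fst x = fst y then M $ snd x $ snd y else 0)"

definition emb12 :: "(spin_half \<times> spin_half \<Rightarrow> spin_half \<times> spin_half \<Rightarrow> complex) \<Rightarrow> 'c::finite two_aux_op" where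
  "emb12 f = (\<chi> x y. if snd (snd x) = snd (snd y)
     then f (fst x, fst (snd x)) (fst y, fst (snd y)) else 0)"

lemma emb1_entry: "emb1 M $ (a, b, s) $ (c, d, t) = (if b = d then M $ (a, s) $ (c, t) else 0)"
  by (simp add: emb1_def)

lemma emb2_entry: "emb2 M $ (a, b, s) $ (c, d, t) = (if a = c then M $ (b, s) $ (d, t) else 0)"
  by (simp add: emb2_def)

lemma emb12_entry: "emb12 f $ (a, b, s) $ (c, d, t) = (if s = t then f (a, b) (c, d) else 0)"
  by (simp add: emb12_def)

lemma mult_entry: "(X ** Y) $ i $ j = (\<Sum>k\<in>UNIV. X $ i $ k * Y $ k $ j)"
  by (simp add: matrix_matrix_mult_def)

lemma if_mult_0: "(if P then x else 0) * y = (if P then x * y else (0::'a::semiring_0))"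
  "y * (if P then x else 0) = (if P then y * x else 0)"
  by simp_all

lemma emb1_mult: "emb1 (M ** N) = emb1 M ** emb1 N"
proof -
  have "emb1 (M ** N) $ (a, b, s) $ (c, d, t) = (emb1 M ** emb1 N) $ (a, b, s) $ (c, d, t)" for a b s c d t
    by (cases b; cases d; simp add: emb1_entry mult_entry sum_pair sum_spin_half)
  then show ?thesis by (simp add: vec_eq_iff)
qed

lemma emb2_mult: "emb2 (M ** N) = emb2 M ** emb2 N"
proof -
  have "emb2 (M ** N) $ (a, b, s) $ (c, d, t) = (emb2 M ** emb2 N) $ (a, b, s) $ (c, d, t)" for a b s c d t
    by (cases a; cases c; simp add: emb2_entry mult_entry sum_pair sum_spin_half)
  then show ?thesis by (simp add: vec_eq_iff)
qed

lemma emb_mat_1: "emb1 (mat 1) = mat 1" "emb2 (mat 1) = mat 1"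
  by (auto simp: emb1_def emb2_def mat_def vec_eq_iff)

lemma emb12_mult_left:
  "(emb12 f ** X) $ (a, b, s) $ y = (\<Sum>e\<in>UNIV. \<Sum>g\<in>UNIV. f (a, b) (e, g) * X $ (e, g, s) $ y)"
  by (simp add: mult_entry sum_pair emb12_entry if_mult_0)

lemma emb12_mult_right:
  "(X ** emb12 f) $ x $ (c, d, t) = (\<Sum>e\<in>UNIV. \<Sum>g\<in>UNIV. X $ x $ (e, g, t) * f (e, g) (c, d))"
  by (simp add: mult_entry sum_pair emb12_entry if_mult_0)

text \<open>In the auxiliary indices the product splits into two entries, multiplied as operators on
  the chain. This is how relations with two auxiliary spaces become commutation relations of
  monodromy entries.\<close>

lemma emb1_emb2_entry:
  "(emb1 M ** emb2 N) $ (a, b, s) $ (c, d, t) = (\<Sum>u\<in>UNIV. M $ (a, s) $ (c, u) * N $ (b, u) $ (d, t))"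
proof -
  have "(emb1 M ** emb2 N) $ (a, b, s) $ (c, d, t) =
     (\<Sum>e\<in>UNIV. \<Sum>f\<in>UNIV. if b = f \<and> e = c then (\<Sum>u\<in>UNIV. M $ (a, s) $ (e, u) * N $ (f, u) $ (d, t)) else 0)"
    by (auto simp: mult_entry sum_pair emb1_entry emb2_entry if_mult_0 intro!: sum.cong sum.neutral)
  then show ?thesis by (cases b; cases c; simp add: sum_spin_half)
qed

lemma emb2_emb1_entry:
  "(emb2 N ** emb1 M) $ (a, b, s) $ (c, d, t) = (\<Sum>u\<in>UNIV. N $ (b, s) $ (d, u) * M $ (a, u) $ (c, t))"
proof -
  have "(emb2 N ** emb1 M) $ (a, b, s) $ (c, d, t) =
     (\<Sum>e\<in>UNIV. \<Sum>f\<in>UNIV. if a = e \<and> f = d then (\<Sum>u\<in>UNIV. N $ (b, s) $ (f, u) * M $ (e, u) $ (c, t)) else 0)"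
    by (auto simp: mult_entry sum_pair emb1_entry emb2_entry if_mult_0 intro!: sum.cong sum.neutral)
  then show ?thesis by (cases a; cases d; simp add: sum_spin_half)
qed

section \<open>Reduction to a single site\<close>

definition agree_off :: "'n \<Rightarrow> ('n \<Rightarrow> 'b) \<Rightarrow> ('n \<Rightarrow> 'b) \<Rightarrow> bool" where
  "agree_off j s t \<longleftrightarrow> (\<forall>k. k \<noteq> j \<longrightarrow> s k = t k)"

lemma agree_off_upd: "agree_off j (s(j := m)) t \<longleftrightarrow> agree_off j s t"
  by (simp add: agree_off_def)

lemma agree_off_refl: "agree_off j s s"
  by (simp add: agree_off_def)

lemma agree_offD: "agree_off j s t \<Longrightarrow> s = t \<longleftrightarrow> s j = t j"
  by (auto simp: agree_off_def)

text \<open>A configuration agreeing with \<open>s\<close> off \<open>j\<close> is fixed by its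
  value at \<open>j\<close>, so the sums over the chain produced by a one-site operator shrink to
  three terms.\<close>

lemma sum_agree_off:
  fixes F :: "('n::finite \<Rightarrow> spin_one) \<Rightarrow> 'a::comm_monoid_add"
  shows "(\<Sum>u\<in>UNIV. if agree_off j s u then F u else 0) = (\<Sum>m\<in>UNIV. F (s(j := m)))"
proof -
  have "(\<Sum>u\<in>UNIV. if agree_off j s u then F u else 0) =
        sum F {u. agree_off j s u}"
    by (simp add: sum.If_cases)
  also have "{u. agree_off j s u} = (\<lambda>m. s(j := m)) ` UNIV"
  proof (intro set_eqI iffI)
    fix u assume "u \<in> {u. agree_off j s u}"
    then have "u = s(j := u j)" by (auto simp: agree_off_def)
    then show "u \<in> (\<lambda>m. s(j := m)) ` UNIV" by blast
  qed (auto simp: agree_off_def)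
  also have "sum F \<dots> = (\<Sum>m\<in>UNIV. F (s(j := m)))"
    by (subst sum.reindex) (auto simp: inj_on_def dest: fun_upd_eqD)
  finally show ?thesis .
qed

lemma R_site_entry:
  "R_site q r j z $ (a, s) $ (b, t) =
    (if agree_off j s t then R_mat q r z $ (a, s j) $ (b, t j) else 0)"
  by (auto simp: R_site_def agree_off_def)

lemma emb1_emb2_site:
  "(emb1 (R_site q r j u) ** emb2 (R_site q r j v)) $ (a, b, s) $ (c, d, t) =
     (if agree_off j s t
      then \<Sum>m\<in>UNIV. R_mat q r u $ (a, s j) $ (c, m) * R_mat q r v $ (b, m) $ (d, t j) else 0)"
proof -
  show ?thesis
    unfolding emb1_emb2_entry R_site_entry if_mult_0(1) sum_agree_off agree_off_upd by simp
qed

lemma emb2_emb1_site: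
  "(emb2 (R_site q r j v) ** emb1 (R_site q r j u)) $ (a, b, s) $ (c, d, t) =
     (if agree_off j s t
      then \<Sum>m\<in>UNIV. R_mat q r v $ (b, s j) $ (d, m) * R_mat q r u $ (a, m) $ (c, t j) else 0)"
proof -
  show ?thesis
    unfolding emb2_emb1_entry R_site_entry if_mult_0(1) sum_agree_off agree_off_upd by simp
qed

text \<open>The two operators share no tensor factor: they act through different auxiliary spaces
  and on different sites.\<close>

lemma emb_sites_commute:
  assumes "j \<noteq> k"
  shows "emb1 (R_site q r j u) ** emb2 (R_site q r k v) = emb2 (R_site q r k v) ** emb1 (R_site q r j u)"
proof -
  have "(emb1 (R_site q r j u) ** emb2 (R_site q r k v)) $ (a, b, s) $ (c, d, t) =
        (emb2 (R_site q r k v) ** emb1 (R_site q r j u)) $ (a, b, s) $ (c, d, t)" for a b s c d t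
  proof -
    let ?x = "R_mat q r u $ (a, s j) $ (c, t j) * R_mat q r v $ (b, s k) $ (d, t k)"
    define P where "P \<longleftrightarrow> (\<forall>i. i \<noteq> j \<longrightarrow> i \<noteq> k \<longrightarrow> s i = t i)"
    have 1: "agree_off k (s(j := m)) t \<longleftrightarrow> m = t j \<and> P" for m
      using assms by (auto simp: agree_off_def P_def)
    have 2: "agree_off j (s(k := m)) t \<longleftrightarrow> m = t k \<and> P" for m
      using assms by (auto simp: agree_off_def P_def)
    have "(emb1 (R_site q r j u) ** emb2 (R_site q r k v)) $ (a, b, s) $ (c, d, t) =
       (\<Sum>m\<in>UNIV. if m = t j then (if P then ?x else 0) else 0)"
      unfolding emb1_emb2_entry R_site_entry if_mult_0(1) sum_agree_off 1
      using assms by (intro sum.cong refl) simp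
    moreover have "(emb2 (R_site q r k v) ** emb1 (R_site q r j u)) $ (a, b, s) $ (c, d, t) =
       (\<Sum>m\<in>UNIV. if m = t k then (if P then ?x else 0) else 0)"
      unfolding emb2_emb1_entry R_site_entry if_mult_0(1) sum_agree_off 2
      using assms by (intro sum.cong refl) simp
    ultimately show ?thesis by simp
  qed
  then show ?thesis by (simp add: vec_eq_iff)
qed

lemma RLL:
  assumes "q \<noteq> 0" "u \<noteq> 0" "v \<noteq> 0" "r\<^sup>2 = qbr q * qbr (q\<^sup>2)"
  shows "emb12 (R_half q (u / v)) ** (emb1 (R_site q r j u) ** emb2 (R_site q r j v)) =
         (emb2 (R_site q r j v) ** emb1 (R_site q r j u)) ** emb12 (R_half q (u / v))" (is "?l = ?r")
proof -
  have "?l $ (a, b, s) $ (c, d, t) = ?r $ (a, b, s) $ (c, d, t)" for a b s c d t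
  proof (cases "agree_off j s t")
    case True
    then show ?thesis
      using R_half_RLL[OF assms, of a b "s j" c d "t j"]
      by (simp add: emb12_mult_left emb12_mult_right emb1_emb2_site emb2_emb1_site)
  next
    case False
    then show ?thesis
      unfolding emb12_mult_left emb12_mult_right emb1_emb2_site emb2_emb1_site by simp
  qed
  then show ?thesis by (simp add: vec_eq_iff)
qed

lemma site_qdet:
  assumes "q \<noteq> 0" "u \<noteq> 0" "r\<^sup>2 = qbr q * qbr (q\<^sup>2)"
  shows "emb12 (R_half q (inverse q)) ** (emb1 (R_site q r j u) ** emb2 (R_site q r j (q * u))) =
         mat (qbr (q ^ 3 * u) * qbr u) ** emb12 (R_half q (inverse q))" (is "?l = ?r")
proof -
  have *: "?r $ x $ y = (qbr (q ^ 3 * u) * qbr u) * emb12 (R_half q (inverse q)) $ x $ y" for x y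
    by (simp add: mult_entry mat_def if_mult_0)
  have "?l $ (a, b, s) $ (c, d, t) = ?r $ (a, b, s) $ (c, d, t)" for a b s c d t
  proof (cases "agree_off j s t")
    case True
    note agree_offD[OF True]
    then show ?thesis
      using R_half_qdet[OF assms, of a b "s j" c d "t j"] True unfolding *
      by (auto simp add: emb12_mult_left emb12_entry emb1_emb2_site)
  next
    case False
    then show ?thesis
      unfolding emb12_mult_left * emb1_emb2_site emb12_entry by (auto simp: agree_off_refl)
  qed
  then show ?thesis by (simp add: vec_eq_iff)
qed

section \<open>The monodromy along a list of sites\<close>

definition chain_monodromy :: "complex \<Rightarrow> complex \<Rightarrow> ('n::finite \<Rightarrow> complex) \<Rightarrow> 'n list \<Rightarrow> complex \<Rightarrow> 'n aux_chain_op" where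
  "chain_monodromy q r w xs z = foldr (\<lambda>j M. R_site q r j (inverse q * z / w j) ** M) xs (mat 1)"

lemma chain_monodromy_simps:
  "chain_monodromy q r w [] z = mat 1"
  "chain_monodromy q r w (j # xs) z = R_site q r j (inverse q * z / w j) ** chain_monodromy q r w xs z"
  by (simp_all add: chain_monodromy_def)

lemma matrix_commute_mult:
  fixes X Y E :: "'a::semiring_1 ^ 'n::finite ^ 'n"
  assumes "X ** E = E ** X" "Y ** E = E ** Y"
  shows "(X ** Y) ** E = E ** (X ** Y)"
  by (metis assms matrix_mul_assoc)

lemma emb_site_chain_commute:
  assumes "j \<notin> set xs"
  shows "emb1 (chain_monodromy q r w xs x) ** emb2 (R_site q r j v) = emb2 (R_site q r j v) ** emb1 (chain_monodromy q r w xs x)"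
    and "emb2 (chain_monodromy q r w xs x) ** emb1 (R_site q r j v) = emb1 (R_site q r j v) ** emb2 (chain_monodromy q r w xs x)"
  using assms
proof (induct xs)
  case Nil
  { case 1 show ?case by (simp add: chain_monodromy_simps emb_mat_1) }
  { case 2 show ?case by (simp add: chain_monodromy_simps emb_mat_1) }
next
  case (Cons k xs)
  { case 1
    then have "j \<noteq> k" "j \<notin> set xs" by auto
    then show ?case
      unfolding chain_monodromy_simps emb1_mult
      using Cons(1) emb_sites_commute[of k j] by (intro matrix_commute_mult) simp_all }
  { case 2
    then have "j \<noteq> k" "j \<notin> set xs" by auto
    then show ?case
      unfolding chain_monodromy_simps emb2_mult
      using Cons(2) emb_sites_commute[of j k] by (intro matrix_commute_mult) simp_all }
qed

text \<open>Train argument: the factors of the head site move next to each other past the rest of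
  the chain and are exchanged by \<open>RLL\<close>; the induction hypothesis exchanges the
  rest.\<close>

lemma RTT:
  assumes "q \<noteq> 0" "x \<noteq> 0" "y \<noteq> 0" "r\<^sup>2 = qbr q * qbr (q\<^sup>2)" "\<And>i. w i \<noteq> 0" "distinct xs"
  shows "emb12 (R_half q (x / y)) ** (emb1 (chain_monodromy q r w xs x) ** emb2 (chain_monodromy q r w xs y)) =
         (emb2 (chain_monodromy q r w xs y) ** emb1 (chain_monodromy q r w xs x)) ** emb12 (R_half q (x / y))"
  using assms(6)
proof (induct xs)
  case Nil
  then show ?case by (simp add: chain_monodromy_simps emb_mat_1)
next
  case (Cons j xs)
  let ?R = "emb12 (R_half q (x / y)) :: ('a \<Rightarrow> spin_one) two_aux_op"
  let ?u = "inverse q * x / w j" and ?v = "inverse q * y / w j"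
  let ?L1 = "emb1 (R_site q r j ?u)" and ?L2 = "emb2 (R_site q r j ?v)"
  let ?T1 = "emb1 (chain_monodromy q r w xs x)" and ?T2 = "emb2 (chain_monodromy q r w xs y)"
  have j: "j \<notin> set xs" and IH: "?R ** (?T1 ** ?T2) = (?T2 ** ?T1) ** ?R"
    using Cons by auto
  \<comment> \<open>The inhomogeneity cancels in the ratio, so the same \<open>R_half\<close> serves
    every site.\<close>
  have "?u / ?v = x / y" using assms by (simp add: field_simps)
  then have L: "?R ** (?L1 ** ?L2) = (?L2 ** ?L1) ** ?R"
    using RLL[of q ?u ?v r j] assms by simp
  have "?R ** ((?L1 ** ?T1) ** (?L2 ** ?T2)) = ?R ** (?L1 ** (?T1 ** ?L2) ** ?T2)"
    by (simp add: matrix_mul_assoc)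
  also have "\<dots> = (?R ** (?L1 ** ?L2)) ** (?T1 ** ?T2)"
    by (simp only: emb_site_chain_commute(1)[OF j]) (simp add: matrix_mul_assoc)
  also have "\<dots> = (?L2 ** ?L1) ** (?R ** (?T1 ** ?T2))"
    by (simp only: L) (simp add: matrix_mul_assoc)
  also have "\<dots> = ?L2 ** (?L1 ** ?T2) ** ?T1 ** ?R"
    by (simp only: IH) (simp add: matrix_mul_assoc)
  also have "\<dots> = ((?L2 ** ?T2) ** (?L1 ** ?T1)) ** ?R"
    by (simp only: emb_site_chain_commute(2)[OF j, symmetric]) (simp add: matrix_mul_assoc)
  finally show ?case by (simp add: chain_monodromy_simps emb1_mult emb2_mult)
qed

lemma mat_mult_mat: "mat c ** mat d = (mat (c * d) :: complex ^ 'm::finite ^ 'm)"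
  by (simp add: vec_eq_iff mult_entry mat_def if_mult_0)

text \<open>The train argument again, at the ratio \<open>inverse q\<close>: by
  \<open>site_qdet\<close> each site leaves a scalar, and the scalars multiply.\<close>

lemma chain_monodromy_qdet:
  assumes "q \<noteq> 0" "z \<noteq> 0" "r\<^sup>2 = qbr q * qbr (q\<^sup>2)" "\<And>i. w i \<noteq> 0" "distinct xs"
  shows "emb12 (R_half q (inverse q)) ** (emb1 (chain_monodromy q r w xs (z / q)) ** emb2 (chain_monodromy q r w xs z)) =
         mat (\<Prod>i\<in>set xs. qbr (q * z / w i) * qbr (inverse q * (z / q) / w i)) ** emb12 (R_half q (inverse q))"
  using assms(5)
proof (induct xs)
  case Nil
  then show ?case by (simp add: chain_monodromy_simps emb_mat_1)
next
  case (Cons j xs)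
  let ?R = "emb12 (R_half q (inverse q)) :: ('a \<Rightarrow> spin_one) two_aux_op"
  let ?u = "inverse q * (z / q) / w j" and ?v = "inverse q * z / w j"
  let ?L1 = "emb1 (R_site q r j ?u)" and ?L2 = "emb2 (R_site q r j ?v)"
  let ?T1 = "emb1 (chain_monodromy q r w xs (z / q))" and ?T2 = "emb2 (chain_monodromy q r w xs z)"
  let ?c = "qbr (q * z / w j) * qbr ?u"
  let ?d = "\<Prod>i\<in>set xs. qbr (q * z / w i) * qbr (inverse q * (z / q) / w i)"
  have j: "j \<notin> set xs" and IH: "?R ** (?T1 ** ?T2) = mat ?d ** ?R"
    using Cons by auto
  have "?v = q * ?u" "q ^ 3 * ?u = q * z / w j" using assms by (simp_all add: field_simps power3_eq_cube)
  then have L: "?R ** (?L1 ** ?L2) = mat ?c ** ?R"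
    using site_qdet[of q ?u r j] assms by simp
  have "?R ** ((?L1 ** ?T1) ** (?L2 ** ?T2)) = ?R ** (?L1 ** (?T1 ** ?L2) ** ?T2)"
    by (simp add: matrix_mul_assoc)
  also have "\<dots> = (?R ** (?L1 ** ?L2)) ** (?T1 ** ?T2)"
    by (simp only: emb_site_chain_commute(1)[OF j]) (simp add: matrix_mul_assoc)
  also have "\<dots> = mat ?c ** (?R ** (?T1 ** ?T2))"
    by (simp only: L) (simp add: matrix_mul_assoc)
  also have "\<dots> = mat (?c * ?d) ** ?R"
    by (simp only: IH) (simp add: matrix_mul_assoc mat_mult_mat)
  also have "?c * ?d = (\<Prod>i\<in>set (j # xs). qbr (q * z / w i) * qbr (inverse q * (z / q) / w i))"
    using j by simp
  finally show ?case by (simp add: chain_monodromy_simps emb1_mult emb2_mult)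
qed


section \<open>Commutation relations of the operators A, B, C, D\<close>

lemma mat_mult_entry: "(mat c ** X) $ s $ t = c * X $ s $ t" for X :: "complex ^ 'm::finite ^ 'm"
  by (simp add: mult_entry mat_def if_mult_0)

lemma mat_vec: "mat c *v v = c *s v" for v :: "complex ^ 'm::finite"
  by (simp add: vec_eq_iff matrix_vector_mult_def mat_def if_mult_0)

locale spin_chain =
  fixes q r :: complex and w :: "'n::finite \<Rightarrow> complex" and xs :: "'n list"
  assumes q: "q \<noteq> 0" and r: "r\<^sup>2 = qbr q * qbr (q\<^sup>2)" and w: "w i \<noteq> 0"
    and distinct: "distinct xs" and set_xs: "set xs = UNIV"
begin

text \<open>\<open>T Up Up\<close>, \<open>T Up Dn\<close>, \<open>T Dn Up\<close> and
  \<open>T Dn Dn\<close> are A, B, C and D, for a chain whose sites are multiplied in the order of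
  \<open>xs\<close>.\<close>

definition T :: "spin_half \<Rightarrow> spin_half \<Rightarrow> complex \<Rightarrow> 'n chain_op" where
  "T a b z = aux_block a b (chain_monodromy q r w xs z)"

lemma T_entry: "chain_monodromy q r w xs z $ (a, s) $ (b, t) = T a b z $ s $ t"
  by (simp add: T_def aux_block_def)

lemma RTT_entries:
  assumes "x \<noteq> 0" "y \<noteq> 0"
  shows "(\<Sum>e\<in>UNIV. \<Sum>g\<in>UNIV. R_half q (x / y) (a, b) (e, g) * (T e c x ** T g d y) $ s $ t) =
         (\<Sum>e\<in>UNIV. \<Sum>g\<in>UNIV. (T b g y ** T a e x) $ s $ t * R_half q (x / y) (e, g) (c, d))"
proof -
  have "(emb12 (R_half q (x / y)) ** (emb1 (chain_monodromy q r w xs x) ** emb2 (chain_monodromy q r w xs y)))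
           $ (a, b, s) $ (c, d, t) =
        ((emb2 (chain_monodromy q r w xs y) ** emb1 (chain_monodromy q r w xs x)) ** emb12 (R_half q (x / y)))
           $ (a, b, s) $ (c, d, t)"
    using RTT[OF q assms r w distinct] by simp
  then show ?thesis
    by (simp add: emb12_mult_left emb12_mult_right emb1_emb2_entry emb2_emb1_entry T_entry flip: mult_entry)
qed

lemma qdet_entry:
  assumes "z \<noteq> 0"
  shows "(\<Sum>e\<in>UNIV. \<Sum>g\<in>UNIV. R_half q (inverse q) (a, b) (e, g) * (T e c (z / q) ** T g d z) $ s $ t) =
         (if s = t then a_fun q w z * d_fun q w (z / q) * R_half q (inverse q) (a, b) (c, d) else 0)"
proof -
  have "(emb12 (R_half q (inverse q)) ** (emb1 (chain_monodromy q r w xs (z / q)) ** emb2 (chain_monodromy q r w xs z)))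
           $ (a, b, s) $ (c, d, t) =
        (mat (a_fun q w z * d_fun q w (z / q)) ** emb12 (R_half q (inverse q))) $ (a, b, s) $ (c, d, t)"
    using chain_monodromy_qdet[OF q assms r w distinct]
    by (simp add: a_fun_def d_fun_def prod.distrib set_xs)
  then show ?thesis
    by (simp add: emb12_mult_left emb1_emb2_entry T_entry mat_mult_entry emb12_entry flip: mult_entry)
qed

text \<open>The RTT relation gives commutation only up to the factor \<open>qbr (q * x / y)\<close>.
  Where this vanishes, the relation with \<open>x\<close> and \<open>y\<close> exchanged serves;
  both factors vanish only if \<open>q ^ 4 = 1\<close>.\<close>

lemma BB:
  assumes "x \<noteq> 0" "y \<noteq> 0" "q ^ 4 \<noteq> 1"
  shows "T Up Dn x ** T Up Dn y = T Up Dn y ** T Up Dn x"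
proof -
  have 1: "qbr (q * x / y) * (T Up Dn x ** T Up Dn y) $ s $ t = qbr (q * x / y) * (T Up Dn y ** T Up Dn x) $ s $ t" for s t
    using RTT_entries[OF assms(1,2), of Up Up Dn Dn s t]
    by (simp add: sum_spin_half R_half_def mult.commute)
  have 2: "qbr (q * y / x) * (T Up Dn y ** T Up Dn x) $ s $ t = qbr (q * y / x) * (T Up Dn x ** T Up Dn y) $ s $ t" for s t
    using RTT_entries[OF assms(2,1), of Up Up Dn Dn s t]
    by (simp add: sum_spin_half R_half_def mult.commute)
  have "qbr (q * x / y) \<noteq> 0 \<or> qbr (q * y / x) \<noteq> 0"
  proof (rule ccontr)
    assume "\<not> ?thesis"
    then have "q\<^sup>2 * x\<^sup>2 = y\<^sup>2" "q\<^sup>2 * y\<^sup>2 = x\<^sup>2"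
      using assms q by (simp_all add: qbr_def field_simps power2_eq_square)
    then have "q ^ 4 * x\<^sup>2 = x\<^sup>2" by algebra
    then show False using assms by simp
  qed
  then show ?thesis using 1 2 by (auto simp: vec_eq_iff)
qed

text \<open>The last term is the unwanted one: it drops out when \<open>T Dn Dn y\<close>
  annihilates \<open>v\<close>.\<close>

lemma DB:
  assumes "z \<noteq> 0" "y \<noteq> 0"
  shows "qbr (z / y) *s (T Dn Dn z *v (T Up Dn y *v v)) =
    qbr (q * z / y) *s (T Up Dn y *v (T Dn Dn z *v v)) - qbr q *s (T Up Dn z *v (T Dn Dn y *v v))"
proof -
  have "mat (qbr (z / y)) ** (T Dn Dn z ** T Up Dn y) + mat (qbr q) ** (T Up Dn z ** T Dn Dn y) =
        mat (qbr (q * z / y)) ** (T Up Dn y ** T Dn Dn z)"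
    using RTT_entries[OF assms, of Dn Up Dn Dn]
    by (simp add: vec_eq_iff mat_mult_entry sum_spin_half R_half_def mult.commute add.commute)
  from arg_cong[OF this, of "\<lambda>M. M *v v"] show ?thesis
    by (simp add: matrix_vector_mult_add_rdistrib mat_vec algebra_simps flip: matrix_vector_mul_assoc)
qed

text \<open>Compared with \<open>DB\<close> the ratio \<open>z / y\<close> is inverted, which is why
  C lowers heights where B raises them.\<close>

lemma DC:
  assumes "z \<noteq> 0" "y \<noteq> 0"
  shows "qbr (y / z) *s (T Dn Dn z *v (T Dn Up y *v v)) =
    qbr (q * y / z) *s (T Dn Up y *v (T Dn Dn z *v v)) - qbr q *s (T Dn Up z *v (T Dn Dn y *v v))"
proof -
  have "mat (qbr (y / z)) ** (T Dn Dn z ** T Dn Up y) + mat (qbr q) ** (T Dn Up z ** T Dn Dn y) =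
        mat (qbr (q * y / z)) ** (T Dn Up y ** T Dn Dn z)"
    using RTT_entries[OF assms(2,1), of Dn Dn Up Dn]
    by (simp add: vec_eq_iff mat_mult_entry sum_spin_half R_half_def mult.commute add.commute)
  from arg_cong[OF this, of "\<lambda>M. M *v v"] show ?thesis
    by (simp add: matrix_vector_mult_add_rdistrib mat_vec algebra_simps flip: matrix_vector_mul_assoc)
qed

text \<open>In the relevant row \<open>R_half q (inverse q)\<close> has the entries
  \<open>- qbr q\<close> and \<open>qbr q\<close>, which produce the difference on the left;
  \<open>qbr q\<close> is cancelled using \<open>q\<^sup>2 \<noteq> 1\<close>.\<close>

lemma qdet:
  assumes "z \<noteq> 0" "q\<^sup>2 \<noteq> 1"
  shows "T Up Up (z / q) *v (T Dn Dn z *v v) - T Dn Up (z / q) *v (T Up Dn z *v v) =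
    (a_fun q w z * d_fun q w (z / q)) *s v"
proof -
  have neg: "qbr (inverse q) = - qbr q" by (simp add: qbr_def)
  have nz: "qbr q \<noteq> 0" using assms q by (simp add: qbr_def field_simps power2_eq_square)
  have "(T Up Up (z / q) ** T Dn Dn z - T Dn Up (z / q) ** T Up Dn z) $ s $ t =
      mat (a_fun q w z * d_fun q w (z / q)) $ s $ t" for s t
  proof -
    have "qbr q * ((T Up Up (z / q) ** T Dn Dn z - T Dn Up (z / q) ** T Up Dn z) $ s $ t) =
      qbr q * mat (a_fun q w z * d_fun q w (z / q)) $ s $ t"
      using qdet_entry[OF assms(1), of Up Dn Up Dn s t]
      by (simp add: sum_spin_half R_half_def neg mat_def algebra_simps split: if_splits)
    then show ?thesis using nz by simp
  qed
  then have "T Up Up (z / q) ** T Dn Dn z - T Dn Up (z / q) ** T Up Dn z =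
      mat (a_fun q w z * d_fun q w (z / q))"
    by (simp add: vec_eq_iff)
  from arg_cong[OF this, of "\<lambda>M. M *v v"] show ?thesis
    by (simp add: matrix_vector_mult_diff_rdistrib mat_vec flip: matrix_vector_mul_assoc)
qed

end

subsection \<open>Laurent polynomials of fixed parity\<close>

text \<open>The span of \<open>z\<^bsup>m-1\<^esup>, z\<^bsup>m-3\<^esup>, \<dots>, z\<^bsup>1-m\<^esup>\<close>, up to the value at \<open>0\<close>.\<close>

definition laurent :: "nat \<Rightarrow> (complex \<Rightarrow> complex) \<Rightarrow> bool" where
  "laurent m f \<longleftrightarrow> (\<exists>p. (p = 0 \<or> degree p < m) \<and> (\<forall>z. z \<noteq> 0 \<longrightarrow> z ^ m * f z = z * poly p (z\<^sup>2)))"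

lemma laurentI:
  assumes "p = 0 \<or> degree p < m" "\<And>z. z \<noteq> 0 \<Longrightarrow> z ^ m * f z = z * poly p (z\<^sup>2)"
  shows "laurent m f"
  unfolding laurent_def using assms by blast

lemma laurent_0: "laurent m (\<lambda>_. 0)"
  by (rule laurentI[of 0]) auto

lemma laurent_const: "laurent (Suc 0) (\<lambda>_. c)"
  by (rule laurentI[of "[:c:]"]) auto

lemma laurent_qbr: "c \<noteq> 0 \<Longrightarrow> laurent (Suc (Suc 0)) (\<lambda>z. qbr (c * z))"
  by (rule laurentI[of "[:- inverse c, c:]"])
     (auto simp: qbr_def field_simps power2_eq_square)

lemma laurent_add:
  assumes "laurent m f" "laurent m g"
  shows "laurent m (\<lambda>z. f z + g z)"
proof -
  obtain p p' where "p = 0 \<or> degree p < m" "p' = 0 \<or> degree p' < m"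
    and "\<And>z. z \<noteq> 0 \<Longrightarrow> z ^ m * f z = z * poly p (z\<^sup>2)" "\<And>z. z \<noteq> 0 \<Longrightarrow> z ^ m * g z = z * poly p' (z\<^sup>2)"
    using assms unfolding laurent_def by blast
  then show ?thesis
    by (intro laurentI[of "p + p'"]) (auto simp: degree_add_less algebra_simps)
qed

lemma laurent_sum: "(\<And>i. i \<in> S \<Longrightarrow> laurent m (f i)) \<Longrightarrow> laurent m (\<lambda>z. \<Sum>i\<in>S. f i z)"
  by (induct S rule: infinite_finite_induct) (auto simp: laurent_0 laurent_add)

lemma laurent_mult:
  assumes "laurent m f" "laurent n g" "m + n = Suc k"
  shows "laurent k (\<lambda>z. f z * g z)"
proof -
  obtain p p' where p: "p = 0 \<or> degree p < m" "p' = 0 \<or> degree p' < n"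
    and f: "\<And>z. z \<noteq> 0 \<Longrightarrow> z ^ m * f z = z * poly p (z\<^sup>2)" "\<And>z. z \<noteq> 0 \<Longrightarrow> z ^ n * g z = z * poly p' (z\<^sup>2)"
    using assms(1,2) unfolding laurent_def by blast
  show ?thesis
  proof (rule laurentI[of "p * p'"])
    show "p * p' = 0 \<or> degree (p * p') < k"
      using p assms(3) degree_mult_le[of p p'] by auto
    fix z :: complex assume z: "z \<noteq> 0"
    have "z * (z ^ k * (f z * g z)) = (z ^ m * f z) * (z ^ n * g z)"
      using assms(3) by (metis (no_types, lifting) mult.assoc mult.left_commute power_Suc power_add)
    also have "\<dots> = z * (z * poly (p * p') (z\<^sup>2))"
      using f z by simp
    finally show "z ^ k * (f z * g z) = z * poly (p * p') (z\<^sup>2)"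
      using z by simp
  qed
qed

lemma laurent_cmult: "laurent m f \<Longrightarrow> laurent m (\<lambda>z. c * f z)"
  using laurent_mult[OF laurent_const] by simp

lemma laurent_diff: "laurent m f \<Longrightarrow> laurent m g \<Longrightarrow> laurent m (\<lambda>z. f z - g z)"
  using laurent_add[of m f "\<lambda>z. - 1 * g z"] laurent_cmult[of m g "-1"] by simp

lemma laurent_prod_qbr:
  "finite S \<Longrightarrow> (\<And>i. i \<in> S \<Longrightarrow> c i \<noteq> 0) \<Longrightarrow> laurent (Suc (card S)) (\<lambda>z. \<Prod>i\<in>S. qbr (c i * z))"
proof (induct S rule: finite_induct)
  case empty
  then show ?case using laurent_const by simp
next
  case (insert i S)
  then show ?case
    using laurent_mult[OF laurent_qbr[of "c i"] insert(3)] by simp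
qed

lemma laurent_step2: "laurent m f \<Longrightarrow> laurent (Suc (Suc m)) f"
proof -
  assume "laurent m f"
  then obtain p where p: "p = 0 \<or> degree p < m" and f: "\<And>z. z \<noteq> 0 \<Longrightarrow> z ^ m * f z = z * poly p (z\<^sup>2)"
    unfolding laurent_def by blast
  show ?thesis
  proof (rule laurentI[of "pCons 0 p"])
    show "pCons 0 p = 0 \<or> degree (pCons 0 p) < Suc (Suc m)"
      using p by (auto simp: degree_pCons_eq_if)
    fix z :: complex assume "z \<noteq> 0"
    then show "z ^ Suc (Suc m) * f z = z * poly (pCons 0 p) (z\<^sup>2)"
      using f[of z] by (simp add: power2_eq_square)
  qed
qed

text \<open>A non-zero \<open>p\<close> of degree below \<open>m\<close> has fewer than
  \<open>m\<close> roots, so \<open>m\<close> points with distinct squares suffice. The premise on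
  \<open>card S\<close> is conditional so that infinite \<open>S\<close> qualify as well.\<close>

lemma laurent_eq_0:
  assumes "laurent m f" "0 \<notin> S" "inj_on (\<lambda>z. z\<^sup>2) S" "\<And>z. z \<in> S \<Longrightarrow> f z = 0"
    "finite S \<Longrightarrow> m \<le> card S" "z \<noteq> 0"
  shows "f z = 0"
proof -
  obtain p where p: "p = 0 \<or> degree p < m" and f: "\<And>z. z \<noteq> 0 \<Longrightarrow> z ^ m * f z = z * poly p (z\<^sup>2)"
    using assms(1) unfolding laurent_def by blast
  have "p = 0"
  proof (rule ccontr)
    assume "p \<noteq> 0"
    have sub: "(\<lambda>z. z\<^sup>2) ` S \<subseteq> {x. poly p x = 0}"
    proof safe
      fix z assume "z \<in> S"
      then show "poly p (z\<^sup>2) = 0" using f[of z] assms(2,4) by auto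
    qed
    have fin: "finite {x. poly p x = 0}" using \<open>p \<noteq> 0\<close> by (rule poly_roots_finite)
    then have "finite S" using sub assms(3) finite_imageD finite_subset by blast
    have "card S = card ((\<lambda>z. z\<^sup>2) ` S)" using assms(3) by (simp add: card_image)
    also have "\<dots> \<le> card {x. poly p x = 0}" using fin sub by (rule card_mono)
    also have "\<dots> \<le> degree p" using \<open>p \<noteq> 0\<close> by (rule card_poly_roots_bound)
    finally show False using p \<open>p \<noteq> 0\<close> assms(5)[OF \<open>finite S\<close>] by simp
  qed
  then show ?thesis using f[OF assms(6)] assms(6) by simp
qed

text \<open>Extends identities obtained by dividing by a factor such as \<open>qbr (z / y)\<close>
  to the zeros of that factor.\<close>

lemma laurent_eq_0_cofinite:
  assumes "laurent m f" "\<And>z. z \<noteq> 0 \<Longrightarrow> z\<^sup>2 \<noteq> c \<Longrightarrow> f z = 0" "z \<noteq> 0"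
  shows "f z = 0"
proof -
  obtain N :: nat where N: "norm c < real N" using reals_Archimedean2 by blast
  \<comment> \<open>Natural numbers beyond \<open>norm c\<close> have squares different from
    \<open>c\<close>, which gives infinitely many test points.\<close>
  define S :: "complex set" where "S = of_nat ` {N<..}"
  have *: "(of_nat n)\<^sup>2 \<noteq> c" if "n > N" for n
  proof
    assume "(of_nat n)\<^sup>2 = c"
    then have "norm c = (real n)\<^sup>2" by (metis norm_of_nat norm_power)
    moreover have "real n \<le> (real n)\<^sup>2" using that by (simp add: power2_eq_square)
    ultimately show False using N that by linarith
  qed
  show ?thesis
  proof (rule laurent_eq_0[OF assms(1), of S])
    show "0 \<notin> S" "\<And>z. z \<in> S \<Longrightarrow> f z = 0" using assms(2) * by (auto simp: S_def)
    show "inj_on (\<lambda>z. z\<^sup>2) S"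
      by (auto simp: S_def inj_on_def simp flip: of_nat_power)
    have "infinite S"
      unfolding S_def by (subst finite_image_iff) (auto simp: inj_on_def infinite_Ioi)
    then show "finite S \<Longrightarrow> m \<le> card S" by simp
  qed (fact assms(3))
qed

section \<open>Laurent coefficients of the monodromy and its action on the vacuum\<close>

lemma laurent_R_mat:
  assumes "q \<noteq> 0" "c \<noteq> 0"
  shows "laurent (if a = b then Suc (Suc 0) else Suc 0) (\<lambda>z. R_mat q r (c * z) $ (a, m) $ (b, n))"
proof -
  have *: "laurent (Suc (Suc 0)) (\<lambda>z. qbr (q * (q * (c * z))))" "laurent (Suc (Suc 0)) (\<lambda>z. qbr (q * (c * z)))"
    "laurent (Suc (Suc 0)) (\<lambda>z. qbr (c * z))"
    using laurent_qbr[of "q * (q * c)"] laurent_qbr[of "q * c"] laurent_qbr[of c] assms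
    by (simp_all add: mult.assoc)
  show ?thesis
    by (induct a; induct b; induct m; induct n)
      (simp_all add: R_mat_def doubleton_eq_iff * laurent_0 laurent_const power2_eq_square mult.assoc)
qed

lemma R_site_mult_entry:
  "(R_site q r j u ** M) $ (a, s) $ y =
     (\<Sum>e\<in>UNIV. \<Sum>m\<in>UNIV. R_mat q r u $ (a, s j) $ (e, m) * M $ (e, s(j := m)) $ y)"
proof -
  have "(R_site q r j u ** M) $ (a, s) $ y =
     (\<Sum>e\<in>UNIV. \<Sum>t\<in>UNIV. if agree_off j s t then R_mat q r u $ (a, s j) $ (e, t j) * M $ (e, t) $ y else 0)"
    by (simp add: mult_entry sum_pair R_site_entry if_mult_0(1))
  then show ?thesis by (simp add: sum_agree_off)
qed

text \<open>At each site a diagonal entry of R in the auxiliary space has two coefficients, and a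
  spin flip is constant. Off-diagonal blocks thus have as many coefficients as there are sites,
  diagonal ones one more.\<close>

lemma laurent_chain_monodromy:
  assumes "q \<noteq> 0" "\<And>i. w i \<noteq> 0"
  shows "laurent (length xs + (if a = b then 1 else 0)) (\<lambda>z. chain_monodromy q r w xs z $ (a, s) $ (b, t))"
proof (induct xs arbitrary: a s)
  case Nil
  show ?case
    by (cases "a = b"; cases "s = t")
      (simp_all add: chain_monodromy_simps mat_def laurent_0 laurent_const)
next
  case (Cons j xs)
  have "laurent (length (j # xs) + (if a = b then 1 else 0))
          (\<lambda>z. R_mat q r (inverse q / w j * z) $ (a, s j) $ (e, m) *
               chain_monodromy q r w xs z $ (e, s(j := m)) $ (b, t))" for e m
  proof -
    let ?f = "\<lambda>z. R_mat q r (inverse q / w j * z) $ (a, s j) $ (e, m)"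
    let ?g = "\<lambda>z. chain_monodromy q r w xs z $ (e, s(j := m)) $ (b, t)"
    have f: "laurent (if a = e then Suc (Suc 0) else Suc 0) ?f"
      using assms by (intro laurent_R_mat) auto
    have fg: "laurent (length xs + (if a = e then 1 else 0) + (if e = b then 1 else 0)) (\<lambda>z. ?f z * ?g z)"
      by (rule laurent_mult[OF f Cons]) auto
    show ?thesis
    \<comment> \<open>Flipping away from \<open>a\<close> and back gives two coefficients fewer than
      the diagonal bound, which \<open>laurent_step2\<close> makes up for.\<close>
    proof (cases "a = b \<and> a \<noteq> e")
      case True
      then have "a = b" "e \<noteq> b" "b \<noteq> e" by auto
      then show ?thesis using laurent_step2[OF fg] by simp
    next
      case False
      then have "(if a = e then 1 else 0) + (if e = b then 1 else 0) = (1::nat) + (if a = b then 1 else 0)"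
        by (cases a; cases b; cases e; simp)
      with fg show ?thesis by (simp add: add.assoc)
    qed
  qed
  then show ?case
    by (simp only: chain_monodromy_simps R_site_mult_entry) (intro laurent_sum, simp)
qed

lemma chain_monodromy_support:
  assumes "chain_monodromy q r w xs z $ (a, s) $ (b, t) \<noteq> 0" "i \<notin> set xs"
  shows "s i = t i"
  using assms
proof (induct xs arbitrary: a s)
  case Nil
  then show ?case by (auto simp: chain_monodromy_simps mat_def split: if_splits)
next
  case (Cons j xs)
  then obtain e m where "chain_monodromy q r w xs z $ (e, s(j := m)) $ (b, t) \<noteq> 0"
    unfolding chain_monodromy_simps R_site_mult_entry
    by (metis (no_types, lifting) mult_zero_right sum.neutral)
  with Cons show ?case by fastforce
qed

text \<open>An intermediate auxiliary \<open>Up\<close> would need site \<open>j\<close> in a state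
  other than \<open>UUp\<close> to flip with, but the remaining factors leave that site in its
  vacuum state.\<close>

lemma chain_monodromy_vac:
  assumes "distinct xs"
  shows "chain_monodromy q r w xs z $ (Dn, s) $ (Dn, \<lambda>_. UUp) =
    (if s = (\<lambda>_. UUp) then \<Prod>i\<in>set xs. qbr (inverse q * z / w i) else 0)"
  using assms
proof (induct xs arbitrary: s)
  case Nil
  then show ?case by (simp add: chain_monodromy_simps mat_def)
next
  case (Cons j xs)
  let ?M = "chain_monodromy q r w xs z" and ?u = "inverse q * z / w j"
  have "?M $ (Up, s(j := m)) $ (Dn, \<lambda>_. UUp) = 0" if "m \<noteq> UUp" for m
    using chain_monodromy_support[of q r w xs z Up "s(j := m)" Dn "\<lambda>_. UUp" j] Cons that by auto
  then have Up: "R_mat q r ?u $ (Dn, s j) $ (Up, m) * ?M $ (Up, s(j := m)) $ (Dn, \<lambda>_. UUp) = 0" for m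
    by (cases m; cases "s j") (simp_all add: R_mat_def doubleton_eq_iff)
  have Dn: "R_mat q r ?u $ (Dn, s j) $ (Dn, m) * ?M $ (Dn, s(j := m)) $ (Dn, \<lambda>_. UUp) =
     (if m = UUp then if s = (\<lambda>_. UUp) then qbr ?u * (\<Prod>i\<in>set xs. qbr (inverse q * z / w i)) else 0 else 0)" for m
  proof -
    have 1: "s(j := m) = (\<lambda>_. UUp) \<longleftrightarrow> m = UUp \<and> (\<forall>i. i \<noteq> j \<longrightarrow> s i = UUp)"
      by (auto simp: fun_eq_iff)
    have 2: "s = (\<lambda>_. UUp) \<longleftrightarrow> s j = UUp \<and> (\<forall>i. i \<noteq> j \<longrightarrow> s i = UUp)"
      by (auto simp: fun_eq_iff)
    have "?M $ (Dn, s(j := m)) $ (Dn, \<lambda>_. UUp) = (if s(j := m) = (\<lambda>_. UUp) then \<Prod>i\<in>set xs. qbr (inverse q * z / w i) else 0)"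
      using Cons by simp
    then show ?thesis
      unfolding 1 2 by (cases m; cases "s j") (auto simp: R_mat_def doubleton_eq_iff)
  qed
  show ?case
    unfolding chain_monodromy_simps R_site_mult_entry sum_spin_half Up Dn
    using Cons(2) by simp
qed

context spin_chain
begin

lemma length_xs: "length xs = CARD('n)"
  using distinct set_xs distinct_card by metis

lemma laurent_T: "laurent (CARD('n) + (if a = b then 1 else 0)) (\<lambda>z. (T a b z *v v) $ s)"
  unfolding matrix_vector_mult_def vec_lambda_beta
  using laurent_chain_monodromy[OF q w, of xs a b]
  by (intro laurent_sum) (simp add: T_def aux_block_def length_xs mult.commute laurent_cmult)

lemma D_vac: "T Dn Dn z *v vac = d_fun q w z *s vac"
  by (simp add: vec_eq_iff vac_def matrix_vector_mult_def T_def aux_block_def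
      chain_monodromy_vac[OF distinct] d_fun_def set_xs axis_def if_mult_0)

end

subsection \<open>The basis of height states\<close>

lemma qbr_eq_0_iff: "x \<noteq> 0 \<Longrightarrow> qbr x = 0 \<longleftrightarrow> x\<^sup>2 = 1"
  by (simp add: qbr_def field_simps power2_eq_square)

lemma qbr_inverse: "qbr (inverse x) = - qbr x"
  by (simp add: qbr_def)

lemma mult_vec_sum: "A *v (\<Sum>i\<in>S. f i) = (\<Sum>i\<in>S. A *v f i)"
  for A :: "complex ^ 'm::finite ^ 'k::finite"
  by (induct S rule: infinite_finite_induct) (simp_all add: matrix_vector_right_distrib)

lemma scalar_product_mult_vec: "scalar_product x (M *v v) = scalar_product (x v* M) v"
  for M :: "complex ^ 'm::finite ^ 'k::finite"
  unfolding scalar_product_def matrix_vector_mult_def vector_matrix_mult_def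
  by (simp add: sum_distrib_left sum_distrib_right mult_ac) (rule sum.swap)

lemma scalar_product_simps:
  "scalar_product x (u + v) = scalar_product x u + scalar_product x v"
  "scalar_product x (u - v) = scalar_product x u - scalar_product x v"
  "scalar_product x (- u) = - scalar_product x u"
  "scalar_product x (c *s u) = c * scalar_product x u"
  "scalar_product (c *s x) u = c * scalar_product x u"
  "scalar_product x 0 = 0" "scalar_product 0 x = 0"
  for x :: "complex ^ 'm::finite"
  by (simp_all add: scalar_product_def sum.distrib sum_subtractf sum_negf sum_distrib_left algebra_simps)

text \<open>Heights are integers here because raising 2 and lowering 0 produce the values 3 and -1,
  which have to be ruled out.\<close>

definition shift :: "('n \<Rightarrow> int) \<Rightarrow> 'n \<Rightarrow> int \<Rightarrow> 'n \<Rightarrow> int" where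
  "shift h j k = h(j := h j + k)"

fun height :: "spin_one \<Rightarrow> nat" where
  "height UUp = 0" | "height Zero = 1" | "height DDn = 2"

lemma height_le: "height m \<le> 2"
  by (cases m) auto

lemma inj_height: "height m = height m' \<longleftrightarrow> m = m'"
  by (cases m; cases m') auto

lemma ex_height: "k \<le> 2 \<Longrightarrow> \<exists>m. height m = k"
proof -
  assume "k \<le> 2"
  then have "k = 0 \<or> k = 1 \<or> k = 2" by auto
  then show ?thesis by (metis height.simps)
qed

lemma heights_induct [case_names zero Suc]:
  fixes h :: "'n::finite \<Rightarrow> nat"
  assumes "P (\<lambda>_. 0)" "\<And>h j. P h \<Longrightarrow> P (h(j := Suc (h j)))"
  shows "P h"
proof (induct "sum h UNIV" arbitrary: h)
  case 0
  then have "h = (\<lambda>_. 0)" by auto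
  then show ?case using assms(1) by simp
next
  case (Suc n)
  then obtain j where j: "h j \<noteq> 0"
    by (metis (no_types, lifting) nat.distinct(1) sum.neutral)
  define h' where "h' = h(j := h j - 1)"
  have "sum h UNIV = h j + sum h (UNIV - {j})" by (simp add: sum.remove)
  moreover have "sum h' UNIV = h' j + sum h' (UNIV - {j})" by (simp add: sum.remove)
  moreover have "sum h' (UNIV - {j}) = sum h (UNIV - {j})"
    by (rule sum.cong) (auto simp: h'_def)
  ultimately have "n = sum h' UNIV" using Suc(2) j by (simp add: h'_def)
  from Suc(1)[OF this] have "P (h'(j := Suc (h' j)))" by (rule assms(2))
  moreover have "h'(j := Suc (h' j)) = h" using j by (auto simp: h'_def)
  ultimately show ?case by simp
qed

lemma mset_height_factors:
  "mset (height_factors h) = (\<Sum>j\<in>UNIV. mset (map (Pair j) [0..<h j]))"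
proof -
  have "mset (height_factors h) = (\<Sum>j\<leftarrow>sites. mset (map (Pair j) [0..<h j]))"
    by (simp add: height_factors_def mset_concat o_def)
  also have "\<dots> = (\<Sum>j\<in>set sites. mset (map (Pair j) [0..<h j]))"
    by (rule sum_list_distinct_conv_sum_set) (simp add: sites_def)
  finally show ?thesis by (simp add: sites_def)
qed

text \<open>As the raising operators commute, a height state depends only on this multiset, and one
  more unit at \<open>j\<close> means one more factor.\<close>

lemma mset_height_factors_Suc:
  "mset (height_factors (h(j := Suc (h j)))) = add_mset (j, h j) (mset (height_factors h))"
proof -
  have "mset (height_factors (h(j := Suc (h j)))) =
     mset (map (Pair j) [0..<Suc (h j)]) + (\<Sum>i\<in>UNIV - {j}. mset (map (Pair i) [0..<(h(j := Suc (h j))) i]))"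
    unfolding mset_height_factors by (subst sum.remove[of _ j]) simp_all
  also have "(\<Sum>i\<in>UNIV - {j}. mset (map (Pair i) [0..<(h(j := Suc (h j))) i])) =
     (\<Sum>i\<in>UNIV - {j}. mset (map (Pair i) [0..<h i]))"
    by (rule sum.cong) auto
  also have "mset (map (Pair j) [0..<Suc (h j)]) + \<dots> = add_mset (j, h j) (mset (height_factors h))"
    unfolding mset_height_factors by (subst (2) sum.remove[of _ j]) simp_all
  finally show ?thesis .
qed

lemma foldr_multiset_equiv:
  assumes "\<And>x y. f x \<circ> f y = f y \<circ> f x" "mset xs = mset ys"
  shows "foldr f xs = foldr f ys"
  using fold_multiset_equiv[of "rev xs" f "rev ys"] assms by (simp add: foldr_conv_fold)

text \<open>The bounds 8 and 4 are those that \<open>qbr_ratio_eq_0\<close> needs for exponents of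
  absolute value at most 4. Differences of heights stay in this range even when the values -1 and 3
  occur.\<close>

locale generic_chain = spin_chain q r w xs
  for q r :: complex and w :: "'n::{finite,linorder} \<Rightarrow> complex" and xs +
  assumes q_powers: "\<And>k. 1 \<le> k \<Longrightarrow> k \<le> 8 \<Longrightarrow> q ^ k \<noteq> 1"
    and w_ratios: "\<And>i j k. i \<noteq> j \<Longrightarrow> k \<le> 4 \<Longrightarrow> q ^ (2 * k) * (w i)\<^sup>2 \<noteq> (w j)\<^sup>2"
begin

lemma qbr_ratio_eq_0:
  assumes "\<bar>n\<bar> \<le> 4"
  shows "qbr (q powi n * w i / w j) = 0 \<longleftrightarrow> i = j \<and> n = 0"
proof -
  have *: "qbr (q ^ m * w i / w j) = 0 \<longleftrightarrow> i = j \<and> m = 0" if "m \<le> 4" for m i j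
  proof -
    have "qbr (q ^ m * w i / w j) = 0 \<longleftrightarrow> q ^ (2 * m) * (w i)\<^sup>2 = (w j)\<^sup>2"
      using q w[of i] w[of j]
      by (subst qbr_eq_0_iff) (auto simp: power_mult_distrib power_divide power_mult[symmetric] mult.commute)
    also have "\<dots> \<longleftrightarrow> i = j \<and> m = 0"
      using w_ratios[of i j m] q_powers[of "2 * m"] w[of j] that by (cases "i = j"; cases "m = 0") auto
    finally show ?thesis .
  qed
  show ?thesis
  proof (cases "n \<ge> 0")
    case True
    then obtain m where "n = int m" using nonneg_int_cases by blast
    then show ?thesis using *[of m i j] assms by simp
  next
    \<comment> \<open>Inversion only changes the sign of \<open>qbr\<close>, so negative exponents
      reduce to positive ones with \<open>i\<close> and \<open>j\<close> exchanged.\<close>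
    case False
    then obtain m where m: "n = - int m" by (metis nonneg_int_cases minus_minus neg_0_le_iff_le linorder_linear)
    have "q powi n * w i / w j = inverse (q ^ m * w j / w i)"
      using m q w[of i] w[of j] by (simp add: power_int_minus field_simps)
    then have "qbr (q powi n * w i / w j) = - qbr (q ^ m * w j / w i)" by (simp only: qbr_inverse)
    then show ?thesis using *[of m j i] assms m by auto
  qed
qed

section \<open>Eigenvectors of D(z) and the zeros of their eigenvalues\<close>

lemma powi_add: "q powi m * q powi n = q powi (m + n)" "q powi m * (q powi n * x) = q powi (m + n) * x"
  using q by (simp_all add: power_int_add)

text \<open>The zero of the \<open>j\<close>th factor of \<open>D_eig h\<close>, and also the
  argument of the B that raises a height ket at \<open>j\<close> from \<open>h j\<close>.\<close>

definition node :: "('n \<Rightarrow> int) \<Rightarrow> 'n \<Rightarrow> complex" where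
  "node h j = q powi (1 - h j) * w j"

definition D_eig :: "('n \<Rightarrow> int) \<Rightarrow> complex \<Rightarrow> complex" where
  "D_eig h z = (\<Prod>i\<in>UNIV. qbr (q powi (h i - 1) / w i * z))"

definition D_eigvec :: "('n \<Rightarrow> int) \<Rightarrow> 'n chain_vec \<Rightarrow> bool" where
  "D_eigvec h v \<longleftrightarrow> (\<forall>z. z \<noteq> 0 \<longrightarrow> T Dn Dn z *v v = D_eig h z *s v)"

lemma node_nonzero: "node h j \<noteq> 0"
  using q w by (simp add: node_def)

lemma D_eig_node: "D_eig h (node h' j) = (\<Prod>i\<in>UNIV. qbr (q powi (h i - h' j) * w j / w i))"
proof -
  have "q powi (h i - 1) / w i * node h' j = q powi (h i - h' j) * w j / w i" for i
    using powi_add(2)[of "h i - 1" "1 - h' j" "w j"] by (simp add: node_def)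
  then show ?thesis by (simp only: D_eig_def)
qed

text \<open>By genericity only the factor \<open>i = j\<close> can vanish, so a node tells apart
  heights that differ at \<open>j\<close>.\<close>

lemma D_eig_node_eq_0:
  assumes "\<And>i. \<bar>h i - h' j\<bar> \<le> 4"
  shows "D_eig h (node h' j) = 0 \<longleftrightarrow> h j = h' j"
  using qbr_ratio_eq_0[OF assms, of _ j] unfolding D_eig_node by (auto simp: prod_zero_iff)

lemma D_eig_node_same: "D_eig h (node h j) = 0"
  unfolding D_eig_node using w by (intro prod_zero bexI[of _ j]) (simp_all add: qbr_def)

lemma D_eig_remove: "D_eig h z = qbr (q powi (h j - 1) / w j * z) * (\<Prod>i\<in>UNIV - {j}. qbr (q powi (h i - 1) / w i * z))"
  unfolding D_eig_def by (simp add: prod.remove)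

lemma D_eig_shift:
  "D_eig (shift h j k) z = qbr (q powi (h j + k - 1) / w j * z) * (\<Prod>i\<in>UNIV - {j}. qbr (q powi (h i - 1) / w i * z))"
proof -
  have "(\<Prod>i\<in>UNIV - {j}. qbr (q powi (shift h j k i - 1) / w i * z)) = (\<Prod>i\<in>UNIV - {j}. qbr (q powi (h i - 1) / w i * z))"
    by (rule prod.cong) (auto simp: shift_def)
  then show ?thesis unfolding D_eig_remove[of _ _ j] by (simp add: shift_def)
qed

lemma node_quot: "q powi (h j + k - 1) / w j * z = q powi k * z / node h j"
  using q w[of j] by (simp add: node_def power_int_diff power_int_add field_simps)

text \<open>The exchange relations determine D(z) only off the zeros of \<open>qbr (z / y)\<close>.
  Both sides are Laurent polynomials, so one excluded square does no harm.\<close>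

lemma D_eigvec_extend:
  assumes "\<And>z. z \<noteq> 0 \<Longrightarrow> z\<^sup>2 \<noteq> c \<Longrightarrow> T Dn Dn z *v v = D_eig h z *s v"
  shows "D_eigvec h v"
proof -
  have "(T Dn Dn z *v v) $ s - D_eig h z * v $ s = 0" if "z \<noteq> 0" for z s
  proof (rule laurent_eq_0_cofinite[where c = c and f = "\<lambda>z. (T Dn Dn z *v v) $ s - D_eig h z * v $ s"])
    have "laurent (Suc CARD('n)) (\<lambda>z. D_eig h z)"
      unfolding D_eig_def using q w by (intro laurent_prod_qbr) auto
    then show "laurent (Suc CARD('n)) (\<lambda>z. (T Dn Dn z *v v) $ s - D_eig h z * v $ s)"
      using laurent_T[of Dn Dn v s] by (intro laurent_diff) (simp_all add: mult.commute laurent_cmult)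
  qed (use that assms in auto)
  then show ?thesis by (simp add: D_eigvec_def vec_eq_iff)
qed

lemma qbr_quot_nonzero: "z \<noteq> 0 \<Longrightarrow> y \<noteq> 0 \<Longrightarrow> z\<^sup>2 \<noteq> y\<^sup>2 \<Longrightarrow> qbr (z / y) \<noteq> 0"
  by (simp add: qbr_eq_0_iff power_divide)

text \<open>D at the node annihilates \<open>v\<close>, so the unwanted term of \<open>DB\<close>
  vanishes. The factor \<open>qbr (q * z / y) / qbr (z / y)\<close> that remains raises the exponent
  in the \<open>j\<close>th factor of the eigenvalue by one.\<close>

lemma D_eigvec_B:
  assumes "D_eigvec h v"
  shows "D_eigvec (shift h j 1) (T Up Dn (node h j) *v v)"
proof (rule D_eigvec_extend[where c = "(node h j)\<^sup>2"])
  fix z :: complex assume z: "z \<noteq> 0" "z\<^sup>2 \<noteq> (node h j)\<^sup>2"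
  let ?y = "node h j" and ?u = "T Up Dn (node h j) *v v"
  have "T Dn Dn ?y *v v = 0"
    using assms by (simp add: D_eigvec_def node_nonzero D_eig_node_same)
  then have "qbr (z / ?y) *s (T Dn Dn z *v ?u) = (qbr (q * z / ?y) * D_eig h z) *s ?u"
    using DB[OF z(1) node_nonzero[of h j], of v] assms z(1)
    by (simp add: D_eigvec_def vector_scalar_commute vector_smult_assoc)
  also have "qbr (q * z / ?y) * D_eig h z = qbr (z / ?y) * D_eig (shift h j 1) z"
    using node_quot[of h j 0 z] node_quot[of h j 1 z] unfolding D_eig_shift D_eig_remove[of h z j] by simp
  finally show "T Dn Dn z *v ?u = D_eig (shift h j 1) z *s ?u"
    using qbr_quot_nonzero[OF z(1) node_nonzero z(2)] by (simp add: vec_eq_iff)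
qed

lemma D_eigvec_C:
  assumes "D_eigvec h v"
  shows "D_eigvec (shift h j (-1)) (T Dn Up (node h j) *v v)"
proof (rule D_eigvec_extend[where c = "(node h j)\<^sup>2"])
  fix z :: complex assume z: "z \<noteq> 0" "z\<^sup>2 \<noteq> (node h j)\<^sup>2"
  let ?y = "node h j" and ?u = "T Dn Up (node h j) *v v"
  have "T Dn Dn ?y *v v = 0"
    using assms by (simp add: D_eigvec_def node_nonzero D_eig_node_same)
  then have "qbr (?y / z) *s (T Dn Dn z *v ?u) = (qbr (q * ?y / z) * D_eig h z) *s ?u"
    using DC[OF z(1) node_nonzero[of h j], of v] assms z(1)
    by (simp add: D_eigvec_def vector_scalar_commute vector_smult_assoc)
  also have "qbr (q * ?y / z) * D_eig h z = qbr (?y / z) * D_eig (shift h j (-1)) z"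
  proof -
    \<comment> \<open>Both ratios are inverted, and the two signs cancel.\<close>
    have "qbr (q powi (-1) * z / ?y) = - qbr (q * ?y / z)" "qbr (z / ?y) = - qbr (?y / z)"
      by (simp_all flip: qbr_inverse add: field_simps)
    then show ?thesis
      using node_quot[of h j 0 z] node_quot[of h j "-1" z] unfolding D_eig_shift D_eig_remove[of h z j] by simp
  qed
  finally show "T Dn Dn z *v ?u = D_eig (shift h j (-1)) z *s ?u"
    using qbr_quot_nonzero[OF node_nonzero z(1) z(2)[symmetric]] by (simp add: vec_eq_iff)
qed

section \<open>Height kets and the action of B and C on them\<close>

definition raise :: "'n \<times> nat \<Rightarrow> 'n chain_vec \<Rightarrow> 'n chain_vec" where
  "raise = (\<lambda>(j, k) v. inverse (a_fun q w (q powi (1 - int k) * w j)) *s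
                         (T Up Dn (q powi (1 - int k) * w j) *v v))"

definition ket :: "('n \<Rightarrow> nat) \<Rightarrow> 'n chain_vec" where
  "ket h = foldr raise (height_factors h) vac"

lemma raise_commute: "raise x \<circ> raise y = raise y \<circ> raise x"
proof -
  have "q ^ 4 \<noteq> 1" using q_powers[of 4] by simp
  then have "T Up Dn (q powi m * w i) *v (T Up Dn (q powi n * w j) *v v) =
     T Up Dn (q powi n * w j) *v (T Up Dn (q powi m * w i) *v v)" for m n i j v
    using BB[of "q powi m * w i" "q powi n * w j"] q w by (simp add: matrix_vector_mul_assoc)
  then show ?thesis
    by (auto simp: raise_def fun_eq_iff vector_scalar_commute vector_smult_assoc mult.commute split: prod.splits)
qed

lemma ket_0: "ket (\<lambda>_. 0) = vac"
proof -
  have "mset (height_factors (\<lambda>_. 0 :: nat)) = mset ([] :: ('n \<times> nat) list)"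
    unfolding mset_height_factors by simp
  then have "height_factors (\<lambda>_. 0 :: nat) = ([] :: ('n \<times> nat) list)" by simp
  then show ?thesis by (simp add: ket_def)
qed

lemma ket_Suc: "ket (h(j := Suc (h j))) = raise (j, h j) (ket h)"
proof -
  have "foldr raise (height_factors (h(j := Suc (h j)))) = foldr raise ((j, h j) # height_factors h)"
    by (rule foldr_multiset_equiv) (simp_all add: raise_commute mset_height_factors_Suc)
  then show ?thesis by (simp add: ket_def)
qed

abbreviation nd :: "('n \<Rightarrow> nat) \<Rightarrow> 'n \<Rightarrow> complex" where
  "nd h j \<equiv> node (\<lambda>i. int (h i)) j"

lemma D_eigvec_smult: "D_eigvec h v \<Longrightarrow> D_eigvec h (c *s v)"
  by (simp add: D_eigvec_def vector_scalar_commute vector_smult_assoc mult.commute)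

lemma D_eigvec_ket: "D_eigvec (\<lambda>i. int (h i)) (ket h)"
proof (induct h rule: heights_induct)
  case zero
  then show ?case
    by (simp add: ket_0 D_eigvec_def D_vac D_eig_def d_fun_def divide_inverse mult_ac)
next
  case (Suc h j)
  have "shift (\<lambda>i. int (h i)) j 1 = (\<lambda>i. int ((h(j := Suc (h j))) i))"
    by (auto simp: shift_def)
  moreover have "D_eigvec (shift (\<lambda>i. int (h i)) j 1) (raise (j, h j) (ket h))"
    using D_eigvec_smult[OF D_eigvec_B[OF Suc, of j]] by (simp add: raise_def node_def)
  ultimately show ?case by (simp only: ket_Suc)
qed

lemma a_fun_node: "a_fun q w (node h j) = (\<Prod>i\<in>UNIV. qbr (q powi (2 - h j) * w j / w i))"
proof -
  have "q * q powi (1 - h j) = q powi (2 - h j)"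
    using powi_add(1)[of 1 "1 - h j"] by simp
  then show ?thesis
    by (simp add: a_fun_def node_def flip: mult.assoc)
qed

lemma d_fun_node: "d_fun q w (node h j) = (\<Prod>i\<in>UNIV. qbr (q powi (- h j) * w j / w i))"
proof -
  have "inverse q * q powi (1 - h j) = q powi (- h j)"
    using powi_add(1)[of "-1" "1 - h j"] by simp
  then show ?thesis
    by (simp add: d_fun_def node_def flip: mult.assoc)
qed

lemma a_fun_node_nonzero: "\<bar>2 - h j\<bar> \<le> 4 \<Longrightarrow> h j \<noteq> 2 \<Longrightarrow> a_fun q w (node h j) \<noteq> 0"
  by (simp add: a_fun_node qbr_ratio_eq_0)

lemma d_fun_node_nonzero: "\<bar>h j\<bar> \<le> 4 \<Longrightarrow> h j \<noteq> 0 \<Longrightarrow> d_fun q w (node h j) \<noteq> 0"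
  by (simp add: d_fun_node qbr_ratio_eq_0)

text \<open>The bound on \<open>h j\<close> keeps the normalising \<open>a_fun\<close> away from its
  zero at \<open>h j = 2\<close>.\<close>

lemma B_ket:
  assumes "h j \<le> 1"
  shows "T Up Dn (nd h j) *v ket h = a_fun q w (nd h j) *s ket (h(j := Suc (h j)))"
  using a_fun_node_nonzero[of "\<lambda>i. int (h i)" j] assms
  by (simp add: ket_Suc raise_def node_def vector_smult_assoc)

text \<open>At \<open>nd h j\<close> the term of the quantum determinant containing D vanishes on
  \<open>ket h\<close>, which leaves C after B; dividing by \<open>q\<close> turns this node into
  that of the raised height.\<close>

lemma C_ket_Suc:
  assumes "h j \<le> 1"
  shows "T Dn Up (nd (h(j := Suc (h j))) j) *v ket (h(j := Suc (h j))) =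
    - d_fun q w (nd (h(j := Suc (h j))) j) *s ket h"
proof -
  let ?z = "nd h j"
  have z: "?z / q = nd (h(j := Suc (h j))) j"
    using q by (simp add: node_def power_int_diff power_int_add power_int_minus field_simps)
  have "q\<^sup>2 \<noteq> 1" using q_powers[of 2] by simp
  moreover have "T Dn Dn ?z *v ket h = 0"
    using D_eigvec_ket[of h] by (simp add: D_eigvec_def node_nonzero D_eig_node_same)
  ultimately have "- (a_fun q w ?z *s (T Dn Up (?z / q) *v ket (h(j := Suc (h j))))) =
      (a_fun q w ?z * d_fun q w (?z / q)) *s ket h"
    using qdet[OF node_nonzero[of "\<lambda>i. int (h i)" j], of "ket h"] B_ket[of h j, OF assms]
    by (simp add: vector_scalar_commute)
  moreover have "a_fun q w ?z \<noteq> 0" using a_fun_node_nonzero[of "\<lambda>i. int (h i)" j] assms by simp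
  ultimately have "T Dn Up (?z / q) *v ket (h(j := Suc (h j))) = - d_fun q w (?z / q) *s ket h"
    by (simp add: vec_eq_iff) (metis (no_types) minus_minus mult.assoc mult_left_cancel mult_minus_right)
  then show ?thesis by (simp only: z)
qed

lemma C_ket:
  assumes "1 \<le> h j" "h j \<le> 2"
  shows "T Dn Up (nd h j) *v ket h = - d_fun q w (nd h j) *s ket (h(j := h j - 1))"
proof -
  let ?h = "h(j := h j - 1)"
  have "?h(j := Suc (?h j)) = h" using assms by auto
  then show ?thesis using C_ket_Suc[of ?h j] assms by simp
qed

text \<open>By \<open>C_ket_Suc\<close> the raised ket is sent by C to a non-zero multiple of the
  lower one, so it cannot vanish.\<close>

lemma ket_nonzero: "\<forall>i. h i \<le> 2 \<Longrightarrow> ket h \<noteq> 0"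
proof (induct h rule: heights_induct)
  case zero
  then show ?case by (simp add: ket_0 vac_def)
next
  case (Suc h j)
  have h: "h i \<le> 2" "h j \<le> 1" for i
    using spec[OF Suc(2), of i] spec[OF Suc(2), of j] by (auto split: if_splits)
  then have "ket h \<noteq> 0" using Suc by simp
  moreover have "d_fun q w (nd (h(j := Suc (h j))) j) \<noteq> 0"
    using h(2) by (intro d_fun_node_nonzero) auto
  ultimately have "T Dn Up (nd (h(j := Suc (h j))) j) *v ket (h(j := Suc (h j))) \<noteq> 0"
    by (simp only: C_ket_Suc[of h j, OF h(2)] vec.scale_eq_0_iff) simp
  then show ?case by (metis matrix_vector_mult_0_right)
qed

section \<open>The height kets form a basis\<close>

abbreviation cket :: "('n \<Rightarrow> spin_one) \<Rightarrow> 'n chain_vec" where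
  "cket s \<equiv> ket (\<lambda>i. height (s i))"

lemma D_cket: "z \<noteq> 0 \<Longrightarrow> T Dn Dn z *v cket s = D_eig (\<lambda>i. int (height (s i))) z *s cket s"
  using D_eigvec_ket by (simp add: D_eigvec_def)

text \<open>The kets are eigenvectors with different eigenvalue functions. For each \<open>s\<close>
  in \<open>S\<close> the point \<open>z\<close> is a zero of the eigenvalue of
  \<open>cket t\<close>, at a site where \<open>s\<close> and \<open>t\<close> differ; D(z) then
  removes the term of \<open>t\<close> but keeps that of \<open>s\<close>.\<close>

lemma ckets_independent:
  assumes "finite S" "(\<Sum>s\<in>S. c s *s cket s) = 0" "s \<in> S"
  shows "c s = 0"
  using assms
proof (induct S arbitrary: c s rule: finite_induct)
  case empty
  then show ?case by simp
next
  case (insert t S)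
  let ?E = "\<lambda>s. D_eig (\<lambda>i. int (height (s i)))"
  have S: "c s = 0" if s: "s \<in> S" for s
  proof -
    obtain j where j: "s j \<noteq> t j" using s insert(2) by (metis ext)
    define z where "z = nd (\<lambda>i. height (t i)) j"
    have z: "z \<noteq> 0" by (simp add: z_def node_nonzero)
    define S' where "S' = insert t S"
    have "(\<Sum>s\<in>S. (c s * (?E s z - ?E t z)) *s cket s) = (\<Sum>s\<in>S'. (c s * (?E s z - ?E t z)) *s cket s)"
      using insert(1,2) by (simp add: S'_def)
    also have "\<dots> = (\<Sum>s\<in>S'. c s *s (T Dn Dn z *v cket s)) - ?E t z *s (\<Sum>s\<in>S'. c s *s cket s)"
      by (simp add: D_cket[OF z] vec_eq_iff sum_distrib_left algebra_simps flip: sum_subtractf)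
    also have "(\<Sum>s\<in>S'. c s *s (T Dn Dn z *v cket s)) = T Dn Dn z *v (\<Sum>s\<in>S'. c s *s cket s)"
      by (simp add: mult_vec_sum vector_scalar_commute)
    also have "(\<Sum>s\<in>S'. c s *s cket s) = 0"
      using insert(4) by (simp only: S'_def)
    finally have "(\<Sum>s\<in>S. (c s * (?E s z - ?E t z)) *s cket s) = 0"
      by simp
    then have "c s * (?E s z - ?E t z) = 0" by (rule insert(3)[OF _ s])
    moreover have "?E t z = 0" by (simp add: z_def D_eig_node_same)
    moreover have "?E s z \<noteq> 0"
    proof -
      have "\<bar>int (height (s i)) - int (height (t j))\<bar> \<le> 4" for i
        using height_le[of "s i"] height_le[of "t j"] by linarith
      from D_eig_node_eq_0[of "\<lambda>i. int (height (s i))" "\<lambda>i. int (height (t i))" j, OF this]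
      show ?thesis unfolding z_def using j by (simp add: inj_height)
    qed
    ultimately show ?thesis by simp
  qed
  then have "c t *s cket t = 0" using insert(1,2,4) by simp
  then have "c t = 0" using ket_nonzero[of "\<lambda>i. height (t i)"] height_le by (auto simp: vec_eq_iff)
  then show ?case using S insert(5) by auto
qed

definition kets :: "'n chain_op" where
  "kets = (\<chi> t s. cket s $ t)"

lemma kets_mult_vec: "kets *v c = (\<Sum>s\<in>UNIV. c $ s *s cket s)"
  by (simp add: vec_eq_iff kets_def matrix_vector_mult_def mult.commute)

lemma vec_mult_kets: "(x v* kets) $ s = scalar_product x (cket s)"
  by (simp add: kets_def vector_matrix_mult_def scalar_product_def mult.commute)

lemma kets_invertible: "\<exists>L. L ** kets = mat 1 \<and> kets ** L = mat 1"
proof -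
  have "c = 0" if "kets *v c = 0" for c
  proof -
    have "c $ s = 0" for s
      by (rule ckets_independent[of UNIV "\<lambda>s. c $ s"]) (use that in \<open>simp_all add: kets_mult_vec\<close>)
    then show ?thesis by (simp add: vec_eq_iff)
  qed
  then obtain L where "L ** kets = mat 1"
    using matrix_left_invertible_ker[of kets] by blast
  then show ?thesis using matrix_left_right_inverse[of L kets] by blast
qed

lemma scalar_product_ckets_inject:
  assumes "\<And>s. scalar_product x (cket s) = scalar_product y (cket s)"
  shows "x = y"
proof -
  obtain L where L: "kets ** L = mat 1" using kets_invertible by blast
  have "x v* kets = y v* kets" using assms by (simp add: vec_eq_iff vec_mult_kets)
  then have "(x v* kets) v* L = (y v* kets) v* L" by simp
  then show ?thesis unfolding vector_matrix_mul_assoc L by simp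
qed

lemma ex_scalar_product_ckets: "\<exists>x. \<forall>s. scalar_product x (cket s) = f s"
proof -
  obtain L where L: "L ** kets = mat 1" using kets_invertible by blast
  let ?x = "(\<chi> s. f s) v* L"
  have "?x v* kets = (\<chi> s. f s)" unfolding vector_matrix_mul_assoc L by simp
  then have "scalar_product ?x (cket s) = f s" for s
    unfolding vec_mult_kets[symmetric] by simp
  then show ?thesis by blast
qed

text \<open>D at \<open>node h j\<close> annihilates \<open>v\<close> but none of the basis kets,
  whose heights at \<open>j\<close> are 0, 1 or 2, so all coefficients of \<open>v\<close> vanish.
  The bounds -1 and 3 keep height differences in the generic range.\<close>

lemma D_eigvec_off_spectrum:
  assumes "D_eigvec h v" "\<And>i. - 1 \<le> h i" "\<And>i. h i \<le> 3" "h j \<notin> {0, 1, 2}"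
  shows "v = 0"
proof -
  obtain L where L: "kets ** L = mat 1" using kets_invertible by blast
  define c where "c = L *v v"
  have v: "v = (\<Sum>s\<in>UNIV. c $ s *s cket s)"
    unfolding kets_mult_vec[symmetric] c_def by (simp add: matrix_vector_mul_assoc L)
  have "c $ s = 0" for s
  proof -
    let ?E = "\<lambda>s. D_eig (\<lambda>i. int (height (s i)))"
    define z where "z = node h j"
    have z: "z \<noteq> 0" by (simp add: z_def node_nonzero)
    have "T Dn Dn z *v v = 0"
      using assms(1) z by (simp add: D_eigvec_def) (simp add: z_def D_eig_node_same)
    then have "(\<Sum>s\<in>UNIV. (c $ s * ?E s z) *s cket s) = 0"
      unfolding v by (simp add: mult_vec_sum D_cket[OF z] vector_scalar_commute vector_smult_assoc)
    then have "c $ s * ?E s z = 0"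
      by (rule ckets_independent[of UNIV "\<lambda>s. c $ s * ?E s z", OF finite]) simp
    moreover have "?E s z \<noteq> 0"
    proof -
      have "\<bar>int (height (s i)) - h j\<bar> \<le> 4" for i
        using height_le[of "s i"] assms(2,3)[of j] by linarith
      from D_eig_node_eq_0[of "\<lambda>i. int (height (s i))" h j, OF this]
      have "?E s z = 0 \<longleftrightarrow> int (height (s j)) = h j" by (simp add: z_def)
      moreover have "int (height (s j)) \<in> {0, 1, 2}" by (cases "s j") auto
      ultimately show ?thesis using assms(4) by metis
    qed
    ultimately show ?thesis by simp
  qed
  then show ?thesis unfolding v by simp
qed

text \<open>The image is an eigenvector with height 3 at \<open>j\<close>, or zero, and the spectrum
  excludes the former.\<close>

lemma B_ket_2:
  assumes "\<And>i. h i \<le> 2" "h j = 2"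
  shows "T Up Dn (nd h j) *v ket h = 0"
proof (rule D_eigvec_off_spectrum[OF D_eigvec_B[OF D_eigvec_ket], where j = j])
  fix i
  show "- 1 \<le> shift (\<lambda>i. int (h i)) j 1 i" by (auto simp: shift_def)
  show "shift (\<lambda>i. int (h i)) j 1 i \<le> 3" using assms(1)[of i] by (auto simp: shift_def)
qed (use assms in \<open>auto simp: shift_def\<close>)

lemma C_ket_0:
  assumes "\<And>i. h i \<le> 2" "h j = 0"
  shows "T Dn Up (nd h j) *v ket h = 0"
proof (rule D_eigvec_off_spectrum[OF D_eigvec_C[OF D_eigvec_ket], where j = j])
  fix i
  show "- 1 \<le> shift (\<lambda>i. int (h i)) j (-1) i" by (auto simp: shift_def)
  show "shift (\<lambda>i. int (h i)) j (-1) i \<le> 3" using assms(1)[of i] by (auto simp: shift_def)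
qed (use assms in \<open>auto simp: shift_def\<close>)

end

subsection \<open>The kernel of the transfer matrix\<close>

context generic_chain
begin

text \<open>The contribution of site \<open>i\<close> to the double product for the
  covector.\<close>

definition weight :: "nat \<Rightarrow> 'n \<Rightarrow> complex" where
  "weight k i = (\<Prod>j\<in>UNIV. qbr (q powi (1 - int k) * w i / w j) / qbr (q * w i / w j))"

lemma weight_0: "weight 0 i = 1"
proof -
  have "qbr (q * w i / w j) \<noteq> 0" for j
    using qbr_ratio_eq_0[of 1 i j] by simp
  then show ?thesis by (simp add: weight_def)
qed

lemma weight_1: "weight (Suc 0) i = 0"
  unfolding weight_def using w[of i] by (intro prod_zero bexI[of _ i]) (simp_all add: qbr_def)

text \<open>At height 1 the values of \<open>d_fun\<close> and \<open>a_fun\<close> at the node are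
  exactly the numerator and the denominator of \<open>weight 2 i\<close>.\<close>

lemma weight_2:
  assumes "h i = 1"
  shows "a_fun q w (node h i) * weight 2 i = d_fun q w (node h i)"
proof -
  have "qbr (q * w i / w j) \<noteq> 0" for j
    using qbr_ratio_eq_0[of 1 i j] by simp
  then show ?thesis
    using assms by (simp add: weight_def a_fun_node d_fun_node flip: prod.distrib)
qed

text \<open>The linear relations satisfied by the pairings of a kernel covector with the height states,
  obtained by evaluating the transfer matrix at the zeros of the eigenvalues of \<open>D\<close>.\<close>

definition kernel_rel :: "(('n \<Rightarrow> nat) \<Rightarrow> complex) \<Rightarrow> bool" where
  "kernel_rel X \<longleftrightarrow> (\<forall>h j. (\<forall>i. h i \<le> 2) \<longrightarrow>
     X (h(j := 1)) = 0 \<and>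
     (h j = 1 \<longrightarrow> a_fun q w (nd h j) * X (h(j := 2)) = d_fun q w (nd h j) * X (h(j := 0))))"

lemma kernel_relD:
  assumes "kernel_rel X" "\<forall>i. h i \<le> 2"
  shows "X (h(j := 1)) = 0"
    and "h j = 1 \<Longrightarrow> a_fun q w (nd h j) * X (h(j := 2)) = d_fun q w (nd h j) * X (h(j := 0))"
  using assms unfolding kernel_rel_def by blast+

lemma kernel_rel_weight: "kernel_rel (\<lambda>h. \<Prod>i\<in>UNIV. weight (h i) i)"
proof -
  have upd: "(\<Prod>i\<in>UNIV. weight ((h(j := k)) i) i) = weight k j * (\<Prod>i\<in>UNIV - {j}. weight (h i) i)" for h j k
    by (subst prod.remove[of _ j]) (auto intro!: prod.cong)
  show ?thesis
    unfolding kernel_rel_def upd using weight_2[of "\<lambda>i. int (_ i)"]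
    by (simp add: weight_0 weight_1)
qed

text \<open>Descent on the total height: a site at height 1 makes both sides zero, a site at height
  2 is brought to 0 by the two-step relation, and otherwise \<open>h\<close> is zero.\<close>

lemma kernel_rel_unique:
  assumes "kernel_rel X" "\<forall>i. h i \<le> 2"
  shows "X h = X (\<lambda>_. 0) * (\<Prod>i\<in>UNIV. weight (h i) i)"
  using assms(2)
proof (induct "sum h UNIV" arbitrary: h rule: less_induct)
  case less
  let ?V = "\<lambda>h. \<Prod>i\<in>UNIV. weight (h i) i"
  consider j where "h j = 1" | j where "h j = 2" | "\<forall>j. h j = 0"
  proof -
    have "h j = 0 \<or> h j = 1 \<or> h j = 2" for j using spec[OF less(2), of j] by linarith
    then show ?thesis using that by metis
  qed
  then show ?case
  proof cases
    case 1
    then have "h(j := 1) = h" by auto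
    then show ?thesis
      using kernel_relD(1)[OF assms(1) less(2), of j] kernel_relD(1)[OF kernel_rel_weight less(2), of j]
      by (simp only: mult_zero_right)
  next
    case 2
    let ?h = "h(j := 1)" and ?g = "h(j := 0)"
    have h: "?h(j := 2) = h" "?h(j := 0) = ?g" "\<forall>i. ?h i \<le> 2" "?h j = 1" "\<forall>i. ?g i \<le> 2"
      using 2 less(2) by auto
    have "sum ?g UNIV < sum h UNIV"
      by (rule sum_strict_mono_ex1) (use 2 in auto)
    then have IH: "X ?g = X (\<lambda>_. 0) * ?V ?g" using less(1) h(5) by blast
    have "a_fun q w (nd ?h j) * X h = d_fun q w (nd ?h j) * X ?g"
      using kernel_relD(2)[OF assms(1) h(3,4)] by (simp only: h(1,2))
    also have "\<dots> = X (\<lambda>_. 0) * (d_fun q w (nd ?h j) * ?V ?g)" by (simp only: IH mult_ac)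
    also have "d_fun q w (nd ?h j) * ?V ?g = a_fun q w (nd ?h j) * ?V h"
      using kernel_relD(2)[OF kernel_rel_weight h(3,4)] by (simp only: h(1,2))
    finally have "a_fun q w (nd ?h j) * X h = a_fun q w (nd ?h j) * (X (\<lambda>_. 0) * ?V h)"
      by (simp only: mult_ac)
    moreover have "a_fun q w (nd ?h j) \<noteq> 0"
      by (rule a_fun_node_nonzero) auto
    ultimately show ?thesis by simp
  next
    case 3
    then have "h = (\<lambda>_. 0)" by auto
    then show ?thesis by (simp add: weight_0)
  qed
qed

section \<open>Reduction of the kernel condition to the nodes\<close>

lemma nd_squares_inj: "\<forall>i. h i \<le> 2 \<Longrightarrow> inj (\<lambda>j. (nd h j)\<^sup>2)"
proof (rule injI)
  fix i j assume h: "\<forall>i. h i \<le> 2" and eq: "(nd h i)\<^sup>2 = (nd h j)\<^sup>2"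
  have "q powi (int (h j) - int (h i)) * w i / w j = nd h i / nd h j"
    using q w[of i] w[of j] by (simp add: node_def power_int_diff power_int_add field_simps)
  moreover have "qbr (nd h i / nd h j) = 0"
    using eq by (subst qbr_eq_0_iff) (simp_all add: node_nonzero power_divide)
  moreover have "\<bar>int (h j) - int (h i)\<bar> \<le> 4"
    using spec[OF h, of i] spec[OF h, of j] by linarith
  ultimately show "i = j" using qbr_ratio_eq_0 by metis
qed

abbreviation BC :: "complex \<Rightarrow> 'n chain_op" where
  "BC z \<equiv> T Up Dn z + T Dn Up z"

text \<open>\<open>B + C\<close> has as few Laurent coefficients as there are nodes.\<close>

lemma left_kernel_nodes:
  "(\<forall>z. z \<noteq> 0 \<longrightarrow> x v* BC z = 0) \<longleftrightarrow>
   (\<forall>h j. (\<forall>i. h i \<le> 2) \<longrightarrow> scalar_product x (BC (nd h j) *v ket h) = 0)" (is "?l \<longleftrightarrow> ?r")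
proof
  assume ?l
  then show ?r by (simp add: scalar_product_mult_vec node_nonzero scalar_product_simps)
next
  assume r: ?r
  show ?l
  proof safe
    fix z :: complex assume z: "z \<noteq> 0"
    \<comment> \<open>The nodes depend on the ket, so the interpolation runs separately for each
      basis ket, whose nodes have distinct squares.\<close>
    have "scalar_product x (BC z *v cket s) = 0" for s
    proof (rule laurent_eq_0[where f = "\<lambda>z. scalar_product x (BC z *v cket s)" and S = "range (nd (\<lambda>i. height (s i)))"])
      let ?h = "\<lambda>i. height (s i)"
      have h: "\<forall>i. ?h i \<le> 2" by (simp add: height_le)
      note inj = nd_squares_inj[OF h]
      show "laurent CARD('n) (\<lambda>z. scalar_product x (BC z *v cket s))"
        using laurent_T[of Up Dn "cket s"] laurent_T[of Dn Up "cket s"]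
        unfolding scalar_product_def
        by (intro laurent_sum laurent_cmult) (simp add: matrix_vector_mult_add_rdistrib laurent_add)
      show "inj_on (\<lambda>z. z\<^sup>2) (range (nd ?h))"
        using inj by (auto simp: inj_on_def)
      show "CARD('n) \<le> card (range (nd ?h))"
        using inj by (subst card_image) (auto simp: inj_on_def)
      show "0 \<notin> range (nd ?h)" by (auto simp: node_nonzero dest: sym)
      show "scalar_product x (BC z *v cket s) = 0" if "z \<in> range (nd ?h)" for z
        using r[rule_format, of ?h] h that by blast
    qed (fact z)
    then show "x v* BC z = 0"
      by (intro scalar_product_ckets_inject) (simp add: scalar_product_mult_vec scalar_product_simps)
  qed
qed

text \<open>At height 0 only B survives and at height 2 only C, and both force the pairing to vanish
  at height 1. At height 1 both terms survive and form the two-step relation.\<close>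

lemma left_kernel_iff:
  "(\<forall>z. z \<noteq> 0 \<longrightarrow> x v* BC z = 0) \<longleftrightarrow> kernel_rel (\<lambda>h. scalar_product x (ket h))"
proof -
  let ?X = "\<lambda>h. scalar_product x (ket h)"
  let ?P = "\<lambda>h j. scalar_product x (BC (nd h j) *v ket h)"
  have P0: "?P h j = a_fun q w (nd h j) * ?X (h(j := 1))" "a_fun q w (nd h j) \<noteq> 0"
    if "\<forall>i. h i \<le> 2" "h j = 0" for h j
    using that B_ket[of h j] C_ket_0[of h j] a_fun_node_nonzero[of "\<lambda>i. int (h i)" j]
    by (simp_all add: matrix_vector_mult_add_rdistrib scalar_product_simps)
  have P1: "?P h j = a_fun q w (nd h j) * ?X (h(j := 2)) - d_fun q w (nd h j) * ?X (h(j := 0))"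
    if "\<forall>i. h i \<le> 2" "h j = 1" for h j
    using that B_ket[of h j] C_ket[of h j]
    by (simp add: matrix_vector_mult_add_rdistrib scalar_product_simps numeral_2_eq_2)
  have P2: "?P h j = - d_fun q w (nd h j) * ?X (h(j := 1))" "d_fun q w (nd h j) \<noteq> 0"
    if "\<forall>i. h i \<le> 2" "h j = 2" for h j
    using that B_ket_2[of h j] C_ket[of h j] d_fun_node_nonzero[of "\<lambda>i. int (h i)" j]
    by (simp_all add: matrix_vector_mult_add_rdistrib scalar_product_simps)
  show ?thesis
    unfolding left_kernel_nodes kernel_rel_def
  proof (intro iffI allI impI conjI)
    fix h :: "'n \<Rightarrow> nat" and j assume P: "\<forall>h j. (\<forall>i. h i \<le> 2) \<longrightarrow> ?P h j = 0" and h: "\<forall>i. h i \<le> (2::nat)"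
    \<comment> \<open>Vanishing at height 1 is read off at height 0, where C contributes
      nothing.\<close>
    have h': "\<forall>i. (h(j := 0)) i \<le> 2" "(h(j := 0)) j = 0" using h by simp_all
    then have "?P (h(j := 0)) j = 0" using P by blast
    then have "?X (h(j := 0, j := 1)) = 0"
      using P0[OF h'] by (metis mult_eq_0_iff)
    then show "?X (h(j := 1)) = 0" by (simp only: fun_upd_upd)
    show "a_fun q w (nd h j) * ?X (h(j := 2)) = d_fun q w (nd h j) * ?X (h(j := 0))" if "h j = 1"
      using P P1 h that by simp
  next
    fix h :: "'n \<Rightarrow> nat" and j assume rel: "\<forall>h j. (\<forall>i. h i \<le> 2) \<longrightarrow> ?X (h(j := 1)) = 0 \<and>
        (h j = 1 \<longrightarrow> a_fun q w (nd h j) * ?X (h(j := 2)) = d_fun q w (nd h j) * ?X (h(j := 0)))"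
      and h: "\<forall>i. h i \<le> (2::nat)"
    have "h j = 0 \<or> h j = 1 \<or> h j = 2" using spec[OF h, of j] by linarith
    moreover have "?X (h(j := 1)) = 0" using rel h by blast
    moreover have "h j = 1 \<longrightarrow> a_fun q w (nd h j) * ?X (h(j := 2)) = d_fun q w (nd h j) * ?X (h(j := 0))"
      using rel h by blast
    ultimately show "?P h j = 0"
      using P0(1)[OF h, of j] P1[OF h, of j] P2(1)[OF h, of j] by (elim disjE) simp_all
  qed
qed

text \<open>Since the kets form a basis, the pairings can be prescribed to be the weights;
  uniqueness of the recursion makes every kernel covector a multiple of the one so obtained.\<close>

theorem left_kernel:
  "\<exists>\<psi>. \<psi> \<noteq> 0 \<and> {x. \<forall>z. z \<noteq> 0 \<longrightarrow> x v* BC z = 0} = vec.span {\<psi>} \<and>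
     (\<forall>h. (\<forall>i. h i \<le> 2) \<longrightarrow> scalar_product \<psi> (ket h) = (\<Prod>i\<in>UNIV. weight (h i) i))"
proof -
  let ?V = "\<lambda>h. \<Prod>i\<in>UNIV. weight (h i) i"
  obtain \<psi> where \<psi>: "\<And>s. scalar_product \<psi> (cket s) = ?V (\<lambda>i. height (s i))"
    using ex_scalar_product_ckets[of "\<lambda>s. ?V (\<lambda>i. height (s i))"] by blast
  have pair: "scalar_product \<psi> (ket h) = ?V h" if "\<forall>i. h i \<le> 2" for h
  proof -
    have "\<forall>i. \<exists>m. height m = h i" using ex_height that by simp
    then obtain s where "\<And>i. height (s i) = h i" by metis
    then show ?thesis using \<psi>[of s] by simp
  qed
  have rel: "kernel_rel (\<lambda>h. scalar_product \<psi> (ket h))"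
    unfolding kernel_rel_def
  proof (intro allI impI)
    fix h :: "'n \<Rightarrow> nat" and j assume h: "\<forall>i. h i \<le> 2"
    then have upd: "scalar_product \<psi> (ket (h(j := k))) = ?V (h(j := k))" if "k \<le> 2" for k
      using that by (intro pair) simp
    have "scalar_product \<psi> (ket (h(j := 0))) = ?V (h(j := 0))"
      "scalar_product \<psi> (ket (h(j := 1))) = ?V (h(j := 1))"
      "scalar_product \<psi> (ket (h(j := 2))) = ?V (h(j := 2))"
      by (rule upd, simp)+
    then show "scalar_product \<psi> (ket (h(j := 1))) = 0 \<and> (h j = 1 \<longrightarrow>
        a_fun q w (nd h j) * scalar_product \<psi> (ket (h(j := 2))) =
        d_fun q w (nd h j) * scalar_product \<psi> (ket (h(j := 0))))"
      using kernel_relD[OF kernel_rel_weight h, of j] by (intro conjI impI) (simp_all only:)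
  qed
  have "\<psi> \<noteq> 0"
    using pair[of "\<lambda>_. 0"] by (auto simp: weight_0 scalar_product_simps)
  moreover have "{x. \<forall>z. z \<noteq> 0 \<longrightarrow> x v* BC z = 0} = vec.span {\<psi>}"
  proof -
    have "(\<forall>z. z \<noteq> 0 \<longrightarrow> x v* BC z = 0) \<longleftrightarrow> (\<exists>c. x = c *s \<psi>)" for x
    proof
      assume "\<forall>z. z \<noteq> 0 \<longrightarrow> x v* BC z = 0"
      then have rel: "kernel_rel (\<lambda>h. scalar_product x (ket h))" by (simp only: left_kernel_iff)
      have "scalar_product x (cket s) = scalar_product x (ket (\<lambda>_. 0)) * scalar_product \<psi> (cket s)" for s
        unfolding \<psi> by (rule kernel_rel_unique[OF rel]) (simp add: height_le)
      then have "x = scalar_product x (ket (\<lambda>_. 0)) *s \<psi>"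
        by (intro scalar_product_ckets_inject) (simp only: scalar_product_simps)
      then show "\<exists>c. x = c *s \<psi>" by blast
    next
      have "\<forall>z. z \<noteq> 0 \<longrightarrow> \<psi> v* BC z = 0"
        using rel by (simp only: left_kernel_iff)
      moreover assume "\<exists>c. x = c *s \<psi>"
      ultimately show "\<forall>z. z \<noteq> 0 \<longrightarrow> x v* BC z = 0"
        by (auto simp: scalar_vector_matrix_assoc)
    qed
    then show ?thesis unfolding vec.span_singleton by auto
  qed
  ultimately show ?thesis using pair by blast
qed

end

section \<open>Transposition of the chain\<close>

lemma R_mat_sym: "R_mat q r z $ x $ y = R_mat q r z $ y $ x"
  by (auto simp: R_mat_def insert_commute)

lemma transpose_R_site: "transpose (R_site q r j z) = R_site q r j z"
proof -
  have "transpose (R_site q r j z) $ (a, s) $ (b, t) = R_site q r j z $ (a, s) $ (b, t)" for a s b t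
    by (auto simp: transpose_def R_site_entry agree_off_def R_mat_sym[of q r z "(a, _)"])
  then show ?thesis by (simp add: vec_eq_iff)
qed

lemma chain_monodromy_append:
  "chain_monodromy q r w (xs @ ys) z = chain_monodromy q r w xs z ** chain_monodromy q r w ys z"
  by (induct xs) (simp_all add: chain_monodromy_simps matrix_mul_assoc)

text \<open>R is symmetric in the site and auxiliary indices together, so transposing the product
  only reverses its factors. On the auxiliary blocks this exchanges B and C.\<close>

lemma transpose_chain_monodromy:
  "transpose (chain_monodromy q r w xs z) = chain_monodromy q r w (rev xs) z"
  by (induct xs)
    (simp_all add: chain_monodromy_simps chain_monodromy_append matrix_transpose_mul transpose_R_site)

text \<open>\<open>fold\<close> places the last site leftmost whereas \<open>chain_monodromy\<close>
  places the head of the list there, hence the reversal.\<close>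

lemma monodromy_eq_chain: "monodromy q r w z = chain_monodromy q r w (rev sites) z"
  by (simp add: monodromy_def chain_monodromy_def foldr_conv_fold)

section \<open>Normalisation of the height bras\<close>

lemma prod_list_upt: "prod_list (map f [0..<n]) = (\<Prod>k<n. f k)" for f :: "nat \<Rightarrow> 'a::comm_monoid_mult"
  by (induct n) simp_all

lemma prod_list_height_factors:
  "prod_list (map c (height_factors h)) = (\<Prod>j\<in>UNIV. \<Prod>k<h j. c (j, k))"
  for c :: "'n::{finite,linorder} \<times> nat \<Rightarrow> 'a::comm_monoid_mult"
proof -
  have "prod_list (map c (concat (map (\<lambda>j. map (Pair j) [0..<h j]) ys))) =
      prod_list (map (\<lambda>j. \<Prod>k<h j. c (j, k)) ys)" for ys
    using prod_list_upt[of "\<lambda>k. c (_, k)"] by (induct ys) (simp_all add: o_def)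
  then have "prod_list (map c (height_factors h)) = prod_list (map (\<lambda>j. \<Prod>k<h j. c (j, k)) sites)"
    by (simp add: height_factors_def)
  also have "\<dots> = (\<Prod>j\<in>set sites. \<Prod>k<h j. c (j, k))"
    by (rule prod.distinct_set_conv_list[symmetric]) (simp add: sites_def)
  finally show ?thesis by (simp add: sites_def)
qed

lemma set_height_factors: "(j, k) \<in> set (height_factors h) \<Longrightarrow> k < h j"
  by (auto simp: height_factors_def)

lemma fold_linear:
  assumes "\<And>x (b::'a::comm_semiring_1) v. f x (b *s v) = b *s f x v"
  shows "fold f xs (b *s v) = b *s fold f xs v"
  by (induct xs arbitrary: v) (simp_all add: assms)

lemma fold_rescaled:
  assumes "\<And>x (b::'a::comm_semiring_1) v. f x (b *s v) = b *s f x v"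
    and "\<And>x v. x \<in> set xs \<Longrightarrow> g x v = c x *s f x v"
  shows "fold g xs v = prod_list (map c xs) *s fold f xs v"
  using assms(2)
  by (induct xs arbitrary: v) (simp_all add: fold_linear[of f] assms(1) vector_smult_assoc mult.commute)

context generic_chain
begin

text \<open>Up to transposition, the bras are the kets with the normalisations \<open>a\<close> replaced by \<open>d\<close>.\<close>

definition bra_factor :: "nat \<Rightarrow> 'n \<Rightarrow> complex" where
  "bra_factor k j = (\<Prod>l<k. a_fun q w (q powi (1 - int l) * w j) / d_fun q w (q powi (- int l) * w j))"

lemma fold_bra_ket:
  assumes "\<forall>i. h i \<le> 2"
  shows "fold (\<lambda>(j, k) v. inverse (d_fun q w (q powi (- int k) * w j)) *s
            (T Up Dn (q powi (1 - int k) * w j) *v v)) (height_factors h) vac =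
         (\<Prod>j\<in>UNIV. bra_factor (h j) j) *s ket h"
proof -
  let ?c = "\<lambda>(j, k). a_fun q w (q powi (1 - int k) * w j) / d_fun q w (q powi (- int k) * w j)"
  have "fold (\<lambda>(j, k) v. inverse (d_fun q w (q powi (- int k) * w j)) *s
            (T Up Dn (q powi (1 - int k) * w j) *v v)) (height_factors h) vac =
      prod_list (map ?c (height_factors h)) *s fold raise (height_factors h) vac"
  proof (rule fold_rescaled)
    fix x :: "'n \<times> nat" and v assume "x \<in> set (height_factors h)"
    moreover obtain j k where x: "x = (j, k)" by (cases x)
    \<comment> \<open>Heights at most 2 involve only the indices 0 and 1, where \<open>a_fun\<close>
      is non-zero and cancels.\<close>
    ultimately have "k < 2" using set_height_factors[of j k h] spec[OF assms, of j] by simp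
    then have "a_fun q w (q powi (1 - int k) * w j) \<noteq> 0"
      using a_fun_node_nonzero[of "\<lambda>_. int k" j] by (simp add: node_def)
    then show "(case x of (j, k) \<Rightarrow> \<lambda>v. inverse (d_fun q w (q powi (- int k) * w j)) *s
            (T Up Dn (q powi (1 - int k) * w j) *v v)) v = ?c x *s raise x v"
      by (simp add: x raise_def vector_smult_assoc divide_inverse)
  qed (simp add: raise_def vector_scalar_commute vector_smult_assoc mult.commute split: prod.split)
  also have "fold raise (height_factors h) = foldr raise (height_factors h)"
    by (rule foldr_fold[symmetric]) (rule raise_commute)
  finally show ?thesis by (simp add: prod_list_height_factors bra_factor_def ket_def)
qed

text \<open>For \<open>k = 2\<close> the factors with exponents 1 and -1 cancel, leaving exponents 2
  and -2. For \<open>k = 1\<close> the factor \<open>j = i\<close> contains \<open>qbr 1 = 0\<close>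
  on both sides.\<close>

lemma bra_factor_weight:
  assumes "k \<le> 2"
  shows "bra_factor k i * weight k i =
    (\<Prod>j\<in>UNIV. qbr (q powi (2 * (int k - 1)) * w i / w j) / qbr (q powi (-2) * w i / w j))"
proof -
  have a: "a_fun q w (q powi (1 - int l) * w i) = (\<Prod>j\<in>UNIV. qbr (q powi (2 - int l) * w i / w j))" for l
    using a_fun_node[of "\<lambda>_. int l" i] by (simp add: node_def)
  have d: "d_fun q w (q powi (- int l) * w i) = (\<Prod>j\<in>UNIV. qbr (q powi (- 1 - int l) * w i / w j))" for l
    using d_fun_node[of "\<lambda>_. 1 + int l" i] by (simp add: node_def)
  have nz: "qbr (q powi n * w i / w j) \<noteq> 0" if "n \<noteq> 0" "\<bar>n\<bar> \<le> 4" for n j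
    using qbr_ratio_eq_0[of n i j] that by simp
  consider "k = 0" | "k = 1" | "k = 2" using assms by linarith
  then show ?thesis
  proof cases
    case 1
    then show ?thesis using nz[of "-2"] by (simp add: bra_factor_def weight_0)
  next
    case 2
    have "(\<Prod>j\<in>UNIV. qbr (q powi (2 * (int k - 1)) * w i / w j) / qbr (q powi (-2) * w i / w j)) = 0"
      using w[of i] 2 by (intro prod_zero bexI[of _ i]) (simp_all add: qbr_def)
    then show ?thesis using 2 by (simp add: weight_1)
  next
    case 3
    have "{..<2} = {0, 1::nat}" by auto
    then have "bra_factor 2 i * weight 2 i = (\<Prod>j\<in>UNIV.
        qbr (q powi 2 * w i / w j) / qbr (q powi (-1) * w i / w j) *
        (qbr (q powi 1 * w i / w j) / qbr (q powi (-2) * w i / w j)) *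
        (qbr (q powi (-1) * w i / w j) / qbr (q powi 1 * w i / w j)))"
      using a[of 0] a[of 1] d[of 0] d[of 1] nz[of 1] nz[of "-1"]
      by (simp add: bra_factor_def weight_def prod.distrib prod_dividef)
    also have "\<dots> = (\<Prod>j\<in>UNIV. qbr (q powi 2 * w i / w j) / qbr (q powi (-2) * w i / w j))"
      using nz[of 1] nz[of "-1"] by (intro prod.cong refl) (simp add: field_simps)
    finally show ?thesis using 3 by simp
  qed
qed

end

text \<open>The right kernel is rewritten as the left kernel of the transposes, with C first because
  its transpose plays the role of B in the reversed chain.\<close>

lemma transfer_kernels:
  fixes w :: "'n::{finite,linorder} \<Rightarrow> complex"
  shows "x v* transfer_AD q r w z = 0 \<longleftrightarrow> x v* (B_op q r w z + C_op q r w z) = 0"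
    and "transfer_AD q r w z *v x = 0 \<longleftrightarrow> x v* (transpose (C_op q r w z) + transpose (B_op q r w z)) = 0"
proof -
  have 1: "x v* transfer_AD q r w z = \<i> *s (x v* (B_op q r w z + C_op q r w z))"
    by (simp add: vec_eq_iff transfer_AD_def vector_matrix_mult_def sum_distrib_left algebra_simps)
  have 2: "transfer_AD q r w z *v x = \<i> *s (x v* (transpose (C_op q r w z) + transpose (B_op q r w z)))"
    by (simp add: vec_eq_iff transfer_AD_def vector_matrix_mult_def matrix_vector_mult_def
        transpose_def sum_distrib_left algebra_simps)
  show "x v* transfer_AD q r w z = 0 \<longleftrightarrow> x v* (B_op q r w z + C_op q r w z) = 0"
    unfolding 1 by simp
  show "transfer_AD q r w z *v x = 0 \<longleftrightarrow> x v* (transpose (C_op q r w z) + transpose (B_op q r w z)) = 0"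
    unfolding 2 by simp
qed

lemma generic_kernels:
  fixes w :: "'n::{finite,linorder} \<Rightarrow> complex"
  assumes q: "q \<noteq> 0" and w: "\<And>i. w i \<noteq> 0" and r: "r\<^sup>2 = qbr q * qbr (q\<^sup>2)"
    and q_powers: "\<And>k. 1 \<le> k \<Longrightarrow> k \<le> 8 \<Longrightarrow> q ^ k \<noteq> 1"
    and w_ratios: "\<And>i j k. i \<noteq> j \<Longrightarrow> k \<le> 4 \<Longrightarrow> q ^ (2 * k) * (w i)\<^sup>2 \<noteq> (w j)\<^sup>2"
  shows "\<exists>\<psi> :: 'n chain_vec. \<psi> \<noteq> 0 \<and>
         {x. \<forall>z. z \<noteq> 0 \<longrightarrow> x v* transfer_AD q r w z = 0} = vec.span {\<psi>} \<and>
         (\<forall>h :: 'n \<Rightarrow> nat. (\<forall>i. h i \<in> {0, 1, 2}) \<longrightarrow>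
            scalar_product \<psi> (height_ket q r w h) =
              (\<Prod>i\<in>UNIV. \<Prod>j\<in>UNIV.
                 qbr (q powi (1 - int (h i)) * w i / w j) / qbr (q * w i / w j)))" (is ?ket)
    and "\<exists>\<phi> :: 'n chain_vec. \<phi> \<noteq> 0 \<and>
         {x. \<forall>z. z \<noteq> 0 \<longrightarrow> transfer_AD q r w z *v x = 0} = vec.span {\<phi>} \<and>
         (\<forall>h :: 'n \<Rightarrow> nat. (\<forall>i. h i \<in> {0, 1, 2}) \<longrightarrow>
            scalar_product (height_bra q r w h) \<phi> =
              (\<Prod>i\<in>UNIV. \<Prod>j\<in>UNIV.
                 qbr (q powi (2 * (int (h i) - 1)) * w i / w j) / qbr (q powi (-2) * w i / w j)))" (is ?bra)
proof -
  \<comment> \<open>\<open>K\<close> is the given chain and handles the covectors; \<open>L\<close>,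
    with the opposite order of sites, is its transpose and handles the vectors.\<close>
  interpret K: generic_chain q r w "rev sites"
    by unfold_locales (use assms in \<open>auto simp: sites_def\<close>)
  interpret L: generic_chain q r w sites
    by unfold_locales (use assms in \<open>auto simp: sites_def\<close>)
  have small: "(\<forall>i. h i \<in> {0, 1, 2}) \<longleftrightarrow> (\<forall>i. h i \<le> 2)" for h :: "'n \<Rightarrow> nat"
    by (intro iff_allI) auto
  have K: "B_op q r w = K.T Up Dn" "C_op q r w = K.T Dn Up"
    by (simp_all add: fun_eq_iff B_op_def C_op_def K.T_def monodromy_eq_chain)
  have L: "transpose (C_op q r w z) = L.T Up Dn z" "transpose (B_op q r w z) = L.T Dn Up z" for z
    using transpose_chain_monodromy[of q r w "rev sites" z]
    by (simp_all add: vec_eq_iff transpose_def B_op_def C_op_def aux_block_def L.T_def monodromy_eq_chain)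
  have ket: "height_ket q r w h = K.ket h" for h
    by (simp add: height_ket_def K.ket_def K.raise_def K)
  show ?ket
    using K.left_kernel unfolding transfer_kernels small ket K K.weight_def .
  have bra: "height_bra q r w h = (\<Prod>j\<in>UNIV. L.bra_factor (h j) j) *s L.ket h" if "\<forall>i. h i \<le> 2" for h
    using L.fold_bra_ket[OF that] by (simp add: height_bra_def flip: L)
  obtain \<phi> where \<phi>: "\<phi> \<noteq> 0" "{x. \<forall>z. z \<noteq> 0 \<longrightarrow> x v* L.BC z = 0} = vec.span {\<phi>}"
    "\<And>h. \<forall>i. h i \<le> 2 \<Longrightarrow> scalar_product \<phi> (L.ket h) = (\<Prod>i\<in>UNIV. L.weight (h i) i)"
    using L.left_kernel by blast
  have "scalar_product (height_bra q r w h) \<phi> = (\<Prod>i\<in>UNIV. \<Prod>j\<in>UNIV.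
      qbr (q powi (2 * (int (h i) - 1)) * w i / w j) / qbr (q powi (-2) * w i / w j))"
    if h: "\<forall>i. h i \<le> 2" for h
  proof -
    have "scalar_product (height_bra q r w h) \<phi> =
        (\<Prod>j\<in>UNIV. L.bra_factor (h j) j) * scalar_product \<phi> (L.ket h)"
      unfolding bra[OF h] scalar_product_simps by (simp add: scalar_product_def mult.commute)
    also have "\<dots> = (\<Prod>i\<in>UNIV. L.bra_factor (h i) i * L.weight (h i) i)"
      unfolding \<phi>(3)[OF h] by (simp only: prod.distrib)
    finally show ?thesis using h by (simp only: L.bra_factor_weight)
  qed
  then show ?bra
    using \<phi>(1,2) unfolding transfer_kernels small L by blast
qed

subsection \<open>Genericity\<close>

lemma poly_funs_diff:
  assumes "f \<in> poly_funs" "g \<in> poly_funs"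
  shows "(\<lambda>x. f x - g x) \<in> poly_funs"
proof -
  have "(\<lambda>x. f x + (- 1) * g x) \<in> poly_funs"
    by (rule poly_funs.add[OF assms(1) poly_funs.mult[OF poly_funs.const assms(2)]])
  then show ?thesis by simp
qed

lemma poly_funs_prod:
  assumes "\<And>i. i \<in> S \<Longrightarrow> f i \<in> poly_funs"
  shows "(\<lambda>x. \<Prod>i\<in>S. f i x) \<in> poly_funs"
  using assms
proof (induct S rule: infinite_finite_induct)
  case (infinite S)
  then show ?case using poly_funs.const[of 1] by simp
next
  case empty
  then show ?case using poly_funs.const[of 1] by simp
next
  case (insert i S)
  have "(\<lambda>x. f i x * (\<Prod>i\<in>S. f i x)) \<in> poly_funs"
    by (rule poly_funs.mult) (use insert in auto)
  then show ?case using insert(1,2) by simp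
qed

lemma poly_funs_power:
  assumes "f \<in> poly_funs"
  shows "(\<lambda>x. f x ^ n) \<in> poly_funs"
proof (induct n)
  case 0
  then show ?case using poly_funs.const[of 1] by simp
next
  case (Suc n)
  show ?case using poly_funs.mult[OF assms Suc] by simp
qed

text \<open>The zero set of a single polynomial serves as exceptional set, and one point where it is
  non-zero shows this set to be proper.\<close>

lemma generically_nonzero:
  assumes "F \<in> poly_funs" "x \<in> param_space" "F x \<noteq> 0"
    and "\<And>q w. q \<noteq> 0 \<Longrightarrow> (\<And>i. w i \<noteq> 0) \<Longrightarrow> F (q, w) \<noteq> 0 \<Longrightarrow> P q w"
  shows "generically P"
proof -
  let ?Z = "{x \<in> param_space. \<forall>f\<in>{F}. f x = 0}"
  have "zariski_closed ?Z" unfolding zariski_closed_def using assms(1) by blast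
  moreover have "?Z \<subset> param_space" using assms(2,3) by blast
  moreover have "\<forall>(q, w) \<in> param_space - ?Z. P q w"
    using assms(4) by (auto simp: param_space_def)
  ultimately show ?thesis unfolding generically_def by blast
qed

lemma two_power_inject: "(2::complex) ^ m = 2 ^ n \<longleftrightarrow> m = n"
proof
  assume "(2::complex) ^ m = 2 ^ n"
  then have "(2::real) ^ m = 2 ^ n" by (metis norm_numeral norm_power)
  then show "m = n" by simp
qed simp

theorem proposition3p2:
  shows "generically (\<lambda>q (w :: 'n::{finite,linorder} \<Rightarrow> complex).
    \<forall>r. r\<^sup>2 = qbr q * qbr (q\<^sup>2) \<longrightarrow>
      (\<exists>\<psi> :: 'n chain_vec. \<psi> \<noteq> 0 \<and>
         {x. \<forall>z. z \<noteq> 0 \<longrightarrow> x v* transfer_AD q r w z = 0} = vec.span {\<psi>} \<and>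
         (\<forall>h :: 'n \<Rightarrow> nat. (\<forall>i. h i \<in> {0, 1, 2}) \<longrightarrow>
            scalar_product \<psi> (height_ket q r w h) =
              (\<Prod>i\<in>UNIV. \<Prod>j\<in>UNIV.
                 qbr (q powi (1 - int (h i)) * w i / w j) / qbr (q * w i / w j)))) \<and>
      (\<exists>\<phi> :: 'n chain_vec. \<phi> \<noteq> 0 \<and>
         {x. \<forall>z. z \<noteq> 0 \<longrightarrow> transfer_AD q r w z *v x = 0} = vec.span {\<phi>} \<and>
         (\<forall>h :: 'n \<Rightarrow> nat. (\<forall>i. h i \<in> {0, 1, 2}) \<longrightarrow>
            scalar_product (height_bra q r w h) \<phi> =
              (\<Prod>i\<in>UNIV. \<Prod>j\<in>UNIV.
                 qbr (q powi (2 * (int (h i) - 1)) * w i / w j) / qbr (q powi (-2) * w i / w j)))))"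
proof -
  \<comment> \<open>\<open>F\<close> is non-zero exactly where both families of inequalities in
    \<open>generic_chain\<close> hold.\<close>
  define F :: "complex \<times> ('n \<Rightarrow> complex) \<Rightarrow> complex" where
    "F = (\<lambda>x. (\<Prod>k\<in>{1..8}. fst x ^ k - 1) *
       (\<Prod>i\<in>UNIV. \<Prod>j\<in>UNIV - {i}. \<Prod>k\<in>{..4}. fst x ^ (2 * k) * (snd x i)\<^sup>2 - (snd x j)\<^sup>2))"
  have F: "F x \<noteq> 0 \<longleftrightarrow> (\<forall>k\<in>{1..8}. fst x ^ k \<noteq> 1) \<and>
      (\<forall>i j. i \<noteq> j \<longrightarrow> (\<forall>k\<le>4. fst x ^ (2 * k) * (snd x i)\<^sup>2 \<noteq> (snd x j)\<^sup>2))" for x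
    unfolding F_def mult_eq_0_iff prod_zero_iff[OF finite] prod_zero_iff[OF finite_atLeastAtMost]
      prod_zero_iff[OF finite_atMost] right_minus_eq de_Morgan_disj bex_simps(8)
    by auto
  obtain idx :: "'n \<Rightarrow> nat" where idx: "inj idx"
    using finite_imp_inj_to_nat_seg[OF finite] by blast
  show ?thesis
  \<comment> \<open>At powers of 2 the inequalities compare exponents: after squaring, those of
    distinct sites differ by at least 20, which exceeds \<open>2 * k \<le> 8\<close>.\<close>
  proof (rule generically_nonzero[of F "(2, \<lambda>i. 2 ^ (10 * idx i))"])
    show "F \<in> poly_funs"
      unfolding F_def
      by (intro poly_funs.mult poly_funs_prod poly_funs_diff poly_funs_power poly_funs.coord_q
          poly_funs.coord_w poly_funs.const)
    show "(2, \<lambda>i. 2 ^ (10 * idx i)) \<in> param_space"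
      by (simp add: param_space_def)
    have 1: "(2::complex) ^ k \<noteq> 1" if "k \<in> {1..8}" for k
      using two_power_inject[of k 0] that by simp
    have 2: "(2::complex) ^ (2 * k) * (2 ^ (10 * idx i))\<^sup>2 \<noteq> (2 ^ (10 * idx j))\<^sup>2"
      if "i \<noteq> j" "k \<le> 4" for i j k
    proof -
      have "idx i \<noteq> idx j" using idx that by (auto simp: inj_def)
      then have "2 * k + 10 * idx i * 2 \<noteq> 10 * idx j * 2" using that by presburger
      then show ?thesis unfolding power_mult[symmetric] power_add[symmetric] two_power_inject .
    qed
    show "F (2, \<lambda>i. 2 ^ (10 * idx i)) \<noteq> 0"
      unfolding F fst_conv snd_conv by (intro conjI ballI allI impI 1 2)
  next
    fix q and w :: "'n \<Rightarrow> complex"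
    assume q: "q \<noteq> 0" and w: "\<And>i. w i \<noteq> 0" and nz: "F (q, w) \<noteq> 0"
    have gen: "q ^ k \<noteq> 1" if "1 \<le> k" "k \<le> 8" for k
      using conjunct1[OF nz[unfolded F fst_conv snd_conv]] that by simp
    have gen': "q ^ (2 * k) * (w i)\<^sup>2 \<noteq> (w j)\<^sup>2" if "i \<noteq> j" "k \<le> 4" for i j k
      by (rule conjunct2[OF nz[unfolded F fst_conv snd_conv], rule_format, OF that])
    show "\<forall>r. r\<^sup>2 = qbr q * qbr (q\<^sup>2) \<longrightarrow>
      (\<exists>\<psi> :: 'n chain_vec. \<psi> \<noteq> 0 \<and>
         {x. \<forall>z. z \<noteq> 0 \<longrightarrow> x v* transfer_AD q r w z = 0} = vec.span {\<psi>} \<and>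
         (\<forall>h :: 'n \<Rightarrow> nat. (\<forall>i. h i \<in> {0, 1, 2}) \<longrightarrow>
            scalar_product \<psi> (height_ket q r w h) =
              (\<Prod>i\<in>UNIV. \<Prod>j\<in>UNIV.
                 qbr (q powi (1 - int (h i)) * w i / w j) / qbr (q * w i / w j)))) \<and>
      (\<exists>\<phi> :: 'n chain_vec. \<phi> \<noteq> 0 \<and>
         {x. \<forall>z. z \<noteq> 0 \<longrightarrow> transfer_AD q r w z *v x = 0} = vec.span {\<phi>} \<and>
         (\<forall>h :: 'n \<Rightarrow> nat. (\<forall>i. h i \<in> {0, 1, 2}) \<longrightarrow>
            scalar_product (height_bra q r w h) \<phi> =
              (\<Prod>i\<in>UNIV. \<Prod>j\<in>UNIV.
                 qbr (q powi (2 * (int (h i) - 1)) * w i / w j) / qbr (q powi (-2) * w i / w j))))"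
      by (intro allI impI conjI generic_kernels[OF q w _ gen gen'])
  qed
qed

end
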